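(* Let $(M,d,0_M)$ and $(N,d,0_N)$ be complete pointed metric spaces and let $f\colon M\to N$ be a Lipschitz map with $f(0_M)=0_N$. Then the operator $\widehat f\colon\mathcal F(M)\to\mathcal F(N)$ is compact if and only if the following three conditions hold: $(P_1)$ for every bounded subset $S\subset M$, $f(S)$ is totally bounded in $N$; $(P_2)$ $f$ is uniformly locally flat, i.e. $\displaystyle\lim_{d(x,y)\to0}\frac{d(f(x),f(y))}{d(x,y)}=0$ (for every $\varepsilon>0$ there is $\delta>0$ such that $d(f(x),f(y))\le\varepsilon d(x,y)$ whenever $0<d(x,y)\le\delta$); $(P_3)$ for every sequence $(x_n,y_n)_n$ in $\widetilde M:=\{(x,y)\in M\times M: x\neq y\}$ such that $\lim_n d(x_n,0_M)=\lim_n d(y_n,0_M)=\infty$, either $(f(x_n),f(y_n))_n$ has an accumulation point in $N\times N$, or $\displaystyle\liminf_{n\to\infty}\frac{d(f(x_n),f(y_n))}{d(x_n,y_n)}=0$.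
   Context: Scalars are $\mathbb K=\mathbb R$ or $\mathbb C$. For a pointed metric space $(M,d,0_M)$, $\mathrm{Lip}_0(M)$ denotes the Banach space of Lipschitz functions $g\colon M\to\mathbb K$ with $g(0_M)=0$, normed by the best Lipschitz constant $\mathrm{Lip}(g)=\sup_{x\neq y}|g(x)-g(y)|/d(x,y)$. For $x\in M$, $\delta(x)\in\mathrm{Lip}_0(M)^*$ is the evaluation functional $\langle g,\delta(x)\rangle=g(x)$. The Lipschitz-free space $\mathcal F(M)$ is the norm-closed linear span of $\{\delta(x):x\in M\}$ in $\mathrm{Lip}_0(M)^*$; its dual is isometrically $\mathrm{Lip}_0(M)$. For a Lipschitz map $f\colon M\to N$ with $f(0_M)=0_N$, $\widehat f\colon\mathcal F(M)\to\mathcal F(N)$ is the unique bounded linear operator with $\widehat f(\delta(x))=\delta(f(x))$ for all $x\in M$ (so $\widehat f(\sum a_i\delta(x_i))=\sum a_i\delta(f(x_i))$ and $\|\widehat f\|=\mathrm{Lip}(f)$). *)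

theory Defs
  imports "HOL-Analysis.Analysis" "HOL-Library.Liminf_Limsup"
begin

definition lip0 :: "'a::metric_space \<Rightarrow> ('a \<Rightarrow> 'k::real_normed_field) set" where
  "lip0 z = {g. g z = 0 \<and> (\<exists>C. \<forall>x y. norm (g x - g y) \<le> C * dist x y)}"

definition lip0_ball :: "'a::metric_space \<Rightarrow> ('a \<Rightarrow> 'k::real_normed_field) set" where
  "lip0_ball z = {g \<in> lip0 z. \<forall>x y. norm (g x - g y) \<le> dist x y}"

text \<open>The dual Lip_0(M)^*: bounded linear functionals on Lip_0(M)
  (normalised to vanish outside Lip_0(M), so that equality is extensional).\<close>
definition lip0_dual :: "'a::metric_space \<Rightarrow> (('a \<Rightarrow> 'k::real_normed_field) \<Rightarrow> 'k) set" where
  "lip0_dual z = {\<Phi>.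
     (\<forall>g h. g \<in> lip0 z \<longrightarrow> h \<in> lip0 z \<longrightarrow> \<Phi> (\<lambda>x. g x + h x) = \<Phi> g + \<Phi> h) \<and>
     (\<forall>c g. g \<in> lip0 z \<longrightarrow> \<Phi> (\<lambda>x. c * g x) = c * \<Phi> g) \<and>
     (\<exists>C. \<forall>g \<in> lip0_ball z. norm (\<Phi> g) \<le> C) \<and>
     (\<forall>g. g \<notin> lip0 z \<longrightarrow> \<Phi> g = 0)}"

definition dual_norm :: "'a::metric_space \<Rightarrow> (('a \<Rightarrow> 'k::real_normed_field) \<Rightarrow> 'k) \<Rightarrow> real" where
  "dual_norm z \<Phi> = (SUP g \<in> lip0_ball z. norm (\<Phi> g))"

definition evalf :: "'a::metric_space \<Rightarrow> 'a \<Rightarrow> ('a \<Rightarrow> 'k::real_normed_field) \<Rightarrow> 'k" where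
  "evalf z x = (\<lambda>g. if g \<in> lip0 z then g x else 0)"

definition free_space :: "'a::metric_space \<Rightarrow> (('a \<Rightarrow> 'k::real_normed_field) \<Rightarrow> 'k) set" where
  "free_space z = {\<Phi> \<in> lip0_dual z. \<forall>\<epsilon>>0. \<exists>P a. finite P \<and>
      dual_norm z (\<lambda>g. \<Phi> g - (\<Sum>p\<in>P. a p * evalf z p g)) < \<epsilon>}"

text \<open>The linearisation hat f: F(M) -> F(N), given by (hat f Phi)(g) = Phi(g o f) for g in Lip_0(N);
  on F(M) this is the unique bounded linear operator with hat f (delta x) = delta (f x).\<close>
definition free_lift :: "'b::metric_space \<Rightarrow> ('a \<Rightarrow> 'b) \<Rightarrow> (('a \<Rightarrow> 'k::real_normed_field) \<Rightarrow> 'k)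
    \<Rightarrow> ('b \<Rightarrow> 'k) \<Rightarrow> 'k" where
  "free_lift zN f \<Phi> = (\<lambda>g. if g \<in> lip0 zN then \<Phi> (g \<circ> f) else 0)"

definition free_lift_compact :: "'k::real_normed_field itself \<Rightarrow> 'a::metric_space \<Rightarrow> 'b::metric_space
    \<Rightarrow> ('a \<Rightarrow> 'b) \<Rightarrow> bool" where
  "free_lift_compact _ zM zN f \<longleftrightarrow>
    (\<forall>s :: nat \<Rightarrow> ('a \<Rightarrow> 'k) \<Rightarrow> 'k.
       (\<forall>n. s n \<in> free_space zM \<and> dual_norm zM (s n) \<le> 1) \<longrightarrow>
       (\<exists>r \<Psi>. strict_mono r \<and> \<Psi> \<in> free_space zN \<and>
          (\<lambda>n. dual_norm zN (\<lambda>g. free_lift zN f (s (r n)) g - \<Psi> g)) \<longlonglongrightarrow> 0))"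

end

theory Submission
  imports Defs "HOL-Library.Diagonal_Subsequence"
begin

text \<open>Compactness of the operator and the three metric conditions are both equivalent to a third
  property: the slopes \<open>g \<mapsto> (g (f x) - g (f y)) / d(x, y)\<close>, which are the images of the molecules
  \<open>(\<delta>(x) - \<delta>(y)) / d(x, y)\<close>, are totally bounded uniformly on the unit ball of \<open>Lip\<^sub>0(N)\<close>.

  If the slopes are totally bounded, a sequence of pairs whose slopes stay away from \<open>0\<close> in norm has
  a subsequence with uniformly Cauchy slopes. Testing them with bump functions shows that \<open>(f x, f y)\<close>
  converges along it to a pair of distinct points, and each metric condition follows.

  Conversely, under the metric conditions \<open>d(f x, 0)\<close> grows sublinearly in \<open>d(x, 0)\<close>. Hence the
  slopes of a sequence of pairs tend to \<open>0\<close>, or along a subsequence \<open>f x\<close>, \<open>f y\<close> and \<open>d(x, y)\<close>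
  converge, the last to a positive limit; in both cases a subsequence of the slopes converges
  uniformly. Finally, total boundedness of the slopes passes to the functions \<open>g \<circ> f\<close> and from these
  to the images of the functionals in the unit ball, each time by the symmetric role of the two
  arguments of a scalar kernel, as in Schauder's theorem. This argument works on the dual side, so
  neither Hahn-Banach nor a description of the unit ball of the free space is needed.\<close>

section \<open>Finite nets and subsequences\<close>

lemma finite_net_or_separated_sequence:
  obtains (net) T where "finite T" "T \<subseteq> A" "\<And>x. x \<in> A \<Longrightarrow> \<exists>t\<in>T. R t x"
  | (separated) s :: "nat \<Rightarrow> 'a" where "range s \<subseteq> A" "\<And>m n. m < n \<Longrightarrow> \<not> R (s m) (s n)"
proof (cases "\<exists>T. finite T \<and> T \<subseteq> A \<and> (\<forall>x\<in>A. \<exists>t\<in>T. R t x)")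
  case True
  then show thesis using net by blast
next
  case no_net: False
  have "\<exists>s. \<forall>n::nat. s n \<in> A \<and> (\<forall>m<n. \<not> R (s m) (s n))"
  proof (rule dependent_wellorder_choice)
    fix n :: nat and s
    assume "\<And>m. m < n \<Longrightarrow> s m \<in> A \<and> (\<forall>l<m. \<not> R (s l) (s m))"
    then have "s ` {..<n} \<subseteq> A" by auto
    then obtain x where "x \<in> A" "\<forall>t\<in>s ` {..<n}. \<not> R t x"
      using no_net finite_imageI[OF finite_lessThan] by metis
    then show "\<exists>x. x \<in> A \<and> (\<forall>m<n. \<not> R (s m) x)" by auto
  qed simp
  then show thesis using separated by blast
qed

lemma frequently_sequentially_subseq:
  assumes "\<exists>\<^sub>F n in sequentially. Q n"
  obtains r :: "nat \<Rightarrow> nat" where "strict_mono r" "\<And>n. Q (r n)"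
proof -
  have "infinite {n. Q n}"
    using assms by (simp add: frequently_cofinite flip: cofinite_eq_sequentially)
  then show thesis
    using infinite_enumerate[of "{n. Q n}"] that by auto
qed

lemma liminf_ereal_neq_0_iff:
  fixes a :: "nat \<Rightarrow> real"
  assumes "\<And>n. 0 \<le> a n"
  shows "liminf (\<lambda>n. ereal (a n)) \<noteq> 0 \<longleftrightarrow> (\<exists>c>0. \<forall>\<^sub>F n in sequentially. c \<le> a n)"
proof
  assume "liminf (\<lambda>n. ereal (a n)) \<noteq> 0"
  moreover have "0 \<le> liminf (\<lambda>n. ereal (a n))"
    using assms by (intro Liminf_bounded) simp
  ultimately have "ereal 0 < liminf (\<lambda>n. ereal (a n))" by (simp add: zero_ereal_def)
  then obtain c where c: "0 < c" "ereal c < liminf (\<lambda>n. ereal (a n))"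
    using ereal_dense2[of "ereal 0"] by auto
  have "\<forall>\<^sub>F n in sequentially. c \<le> a n"
    using less_LiminfD[OF c(2)] by (simp add: eventually_mono)
  with c(1) show "\<exists>c>0. \<forall>\<^sub>F n in sequentially. c \<le> a n" by blast
next
  assume "\<exists>c>0. \<forall>\<^sub>F n in sequentially. c \<le> a n"
  then obtain c where "0 < c" "\<forall>\<^sub>F n in sequentially. c \<le> a n" by blast
  then have "ereal c \<le> liminf (\<lambda>n. ereal (a n))"
    by (intro Liminf_bounded) simp
  then show "liminf (\<lambda>n. ereal (a n)) \<noteq> 0"
    using \<open>0 < c\<close> by (auto simp: zero_ereal_def)
qed

lemma totally_bounded_closure:
  fixes A :: "'a::metric_space set"
  assumes "totally_bounded A"
  shows "totally_bounded (closure A)"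
  unfolding totally_bounded_metric
proof (intro allI impI)
  fix e :: real assume "0 < e"
  then obtain k where k: "finite k" "A \<subseteq> (\<Union>x\<in>k. {y. dist x y < e / 2})"
    using assms unfolding totally_bounded_metric by (meson half_gt_zero)
  note k(2)
  also have "(\<Union>x\<in>k. {y. dist x y < e / 2}) \<subseteq> (\<Union>x\<in>k. cball x (e / 2))"
    by (intro UN_mono) auto
  finally have "A \<subseteq> (\<Union>x\<in>k. cball x (e / 2))" .
  then have "closure A \<subseteq> (\<Union>x\<in>k. cball x (e / 2))"
    using k(1) by (intro closure_minimal closed_UN) auto
  also have "\<dots> \<subseteq> (\<Union>x\<in>k. {y. dist x y < e})"
    using \<open>0 < e\<close> by (intro UN_mono) auto
  finally show "\<exists>k. finite k \<and> closure A \<subseteq> (\<Union>x\<in>k. {y. dist x y < e})"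
    using k(1) by blast
qed

lemma compact_closure_iff_totally_bounded:
  fixes A :: "'a::complete_space set"
  shows "compact (closure A) \<longleftrightarrow> totally_bounded A"
proof -
  have "compact (closure A) \<longleftrightarrow> totally_bounded (closure A)"
    by (simp add: compact_eq_totally_bounded totally_bounded_metric complete_eq_closed ball_def)
  then show ?thesis
    using totally_bounded_closure totally_bounded_subset closure_subset by blast
qed

lemma totally_bounded_if_bounded:
  fixes A :: "'a::heine_borel set"
  assumes "bounded A"
  shows "totally_bounded A"
  using assms by (simp flip: compact_closure_iff_totally_bounded)

section \<open>Total boundedness for the uniform distance\<close>

definition uniformly_totally_bounded_on ::
    "'y set \<Rightarrow> ('x \<Rightarrow> 'y \<Rightarrow> 'c::metric_space) \<Rightarrow> 'x set \<Rightarrow> bool" where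
  "uniformly_totally_bounded_on Y k X \<longleftrightarrow>
    (\<forall>e>0. \<exists>T. finite T \<and> T \<subseteq> X \<and> (\<forall>x\<in>X. \<exists>t\<in>T. \<forall>y\<in>Y. dist (k t y) (k x y) \<le> e))"

lemma uniformly_totally_bounded_on_close_subseq:
  fixes s :: "nat \<Rightarrow> 'x"
  assumes "uniformly_totally_bounded_on Y k X" "range s \<subseteq> X" "0 < e"
  shows "\<exists>r :: nat \<Rightarrow> nat. strict_mono r \<and>
      (\<forall>i j. \<forall>y\<in>Y. dist (k (s (r i)) y) (k (s (r j)) y) < e)"
proof -
  have "0 < e / 3" using assms(3) by simp
  then obtain T where T: "finite T"
    and net: "\<forall>x\<in>X. \<exists>t\<in>T. \<forall>y\<in>Y. dist (k t y) (k x y) \<le> e / 3"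
    using assms(1) unfolding uniformly_totally_bounded_on_def by metis
  have "\<exists>t\<in>T. \<forall>y\<in>Y. dist (k t y) (k (s n) y) \<le> e / 3" for n
    using net assms(2) by (simp add: range_subsetD)
  then have "\<exists>\<^sub>F n in sequentially. \<exists>t\<in>T. \<forall>y\<in>Y. dist (k t y) (k (s n) y) \<le> e / 3"
    by (simp add: eventually_frequently)
  from frequently_bex_finite[OF T this]
  obtain t where "\<exists>\<^sub>F n in sequentially. \<forall>y\<in>Y. dist (k t y) (k (s n) y) \<le> e / 3" ..
  from frequently_sequentially_subseq[OF this] obtain r :: "nat \<Rightarrow> nat" where r: "strict_mono r"
    and near: "\<And>n. \<forall>y\<in>Y. dist (k t y) (k (s (r n)) y) \<le> e / 3" by blast
  have "dist (k (s (r i)) y) (k (s (r j)) y) < e" if "y \<in> Y" for i j y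
  proof -
    have "dist (k (s (r i)) y) (k (s (r j)) y)
        \<le> dist (k t y) (k (s (r i)) y) + dist (k t y) (k (s (r j)) y)"
      by (rule dist_triangle3)
    also have "\<dots> \<le> e / 3 + e / 3"
      using near that by (intro add_mono) blast+
    finally show ?thesis using assms(3) by simp
  qed
  then show ?thesis using r by blast
qed

lemma uniformly_totally_bounded_on_Cauchy_subseq:
  fixes s :: "nat \<Rightarrow> 'x"
  assumes "uniformly_totally_bounded_on Y k X" "range s \<subseteq> X"
  obtains r where "strict_mono r" "uniformly_Cauchy_on Y (\<lambda>n. k (s (r n)))"
proof -
  interpret subseqs "\<lambda>n r. \<forall>i j. \<forall>y\<in>Y. dist (k (s (r i)) y) (k (s (r j)) y) < inverse (Suc n)"
  proof
    fix n and r :: "nat \<Rightarrow> nat"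
    have *: "range (\<lambda>i. s (r i)) \<subseteq> X" using assms(2) by auto
    show "\<exists>r' :: nat \<Rightarrow> nat. strict_mono r' \<and>
        (\<forall>i j. \<forall>y\<in>Y. dist (k (s ((r \<circ> r') i)) y) (k (s ((r \<circ> r') j)) y) < inverse (Suc n))"
      using uniformly_totally_bounded_on_close_subseq[OF assms(1) *, of "inverse (Suc n)"] by simp
  qed
  have diagonal:
    "dist (k (s (diagseq (Suc n + i))) y) (k (s (diagseq (Suc n + j))) y) < inverse (Suc n)"
    if "y \<in> Y" for n i j y
    using diagseq_holds[of n] that by (simp add: o_def)
  have "uniformly_Cauchy_on Y (\<lambda>n. k (s (diagseq n)))"
  proof (rule uniformly_Cauchy_onI)
    fix e :: real assume "0 < e"
    then obtain n where n: "inverse (Suc n) < e" using reals_Archimedean by blast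
    show "\<exists>M. \<forall>y\<in>Y. \<forall>i\<ge>M. \<forall>j\<ge>M. dist (k (s (diagseq i)) y) (k (s (diagseq j)) y) < e"
    proof (intro exI ballI allI impI)
      fix y i j assume "y \<in> Y" "Suc n \<le> i" "Suc n \<le> j"
      then show "dist (k (s (diagseq i)) y) (k (s (diagseq j)) y) < e"
        using diagonal[of y n "i - Suc n" "j - Suc n"] n by simp
    qed
  qed
  then show thesis using that subseq_diagseq by blast
qed

lemma uniformly_totally_bounded_onI:
  assumes "\<And>s :: nat \<Rightarrow> 'x. range s \<subseteq> X \<Longrightarrow>
      \<exists>r. strict_mono r \<and> uniformly_Cauchy_on Y (\<lambda>n. k (s (r n)))"
  shows "uniformly_totally_bounded_on Y k X"
  unfolding uniformly_totally_bounded_on_def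
proof (intro allI impI)
  fix e :: real assume "0 < e"
  show "\<exists>T. finite T \<and> T \<subseteq> X \<and> (\<forall>x\<in>X. \<exists>t\<in>T. \<forall>y\<in>Y. dist (k t y) (k x y) \<le> e)"
  proof (cases X "\<lambda>t x. \<forall>y\<in>Y. dist (k t y) (k x y) \<le> e" rule: finite_net_or_separated_sequence)
    case (separated s)
    then obtain r where r: "strict_mono r" "uniformly_Cauchy_on Y (\<lambda>n. k (s (r n)))"
      using assms by blast
    then obtain M where "\<And>y m n. y \<in> Y \<Longrightarrow> M \<le> m \<Longrightarrow> M \<le> n \<Longrightarrow> dist (k (s (r m)) y) (k (s (r n)) y) < e"
      using \<open>0 < e\<close> unfolding uniformly_Cauchy_on_def by meson
    then have "\<forall>y\<in>Y. dist (k (s (r M)) y) (k (s (r (Suc M))) y) \<le> e"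
      by (simp add: less_imp_le)
    moreover have "r M < r (Suc M)" using r(1) by (simp add: strict_mono_Suc_iff)
    ultimately show ?thesis using separated(2) by blast
  qed blast
qed

text \<open>A point of \<open>Y\<close> is coded by approximate values of the finitely many functions.\<close>

lemma uniformly_totally_bounded_on_finite:
  assumes "finite T" and images: "\<And>t. t \<in> T \<Longrightarrow> totally_bounded (k t ` Y)"
  shows "uniformly_totally_bounded_on T (\<lambda>y t. k t y) Y"
  unfolding uniformly_totally_bounded_on_def
proof (intro allI impI)
  fix e :: real assume "0 < e"
  have "\<exists>V. finite V \<and> (\<forall>y\<in>Y. \<exists>c\<in>V. dist c (k t y) < e / 2)" if "t \<in> T" for t
    using images[OF that] half_gt_zero[OF \<open>0 < e\<close>]
    unfolding totally_bounded_metric image_subset_iff UN_iff mem_Collect_eq by blast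
  then obtain V where V: "\<And>t. t \<in> T \<Longrightarrow> finite (V t)"
    and near: "\<And>t y. t \<in> T \<Longrightarrow> y \<in> Y \<Longrightarrow> \<exists>c\<in>V t. dist c (k t y) < e / 2"
    by metis
  define code where "code y = (\<lambda>t\<in>T. SOME c. c \<in> V t \<and> dist c (k t y) < e / 2)" for y
  have code: "code y t \<in> V t \<and> dist (code y t) (k t y) < e / 2" if "t \<in> T" "y \<in> Y" for t y
    using someI_ex[OF near[OF that, unfolded Bex_def]] that(1) by (simp add: code_def)
  have "code ` Y \<subseteq> PiE T V"
    using code by (intro image_subsetI PiE_I) (simp_all add: code_def)
  then have "finite (code ` Y)"
    using finite_PiE[OF \<open>finite T\<close> V] by (rule finite_subset)
  from finite_subset_image[OF this subset_refl]
  obtain Z where Z: "Z \<subseteq> Y" "finite Z" "code ` Y = code ` Z" by blast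
  have "\<exists>z\<in>Z. \<forall>t\<in>T. dist (k t z) (k t y) \<le> e" if "y \<in> Y" for y
  proof -
    obtain z where z: "z \<in> Z" "code y = code z"
      using Z(3) imageI[OF \<open>y \<in> Y\<close>, of code] by auto
    have "dist (k t z) (k t y) \<le> e" if "t \<in> T" for t
      using dist_triangle3[of "k t z" "k t y" "code z t"] code[OF that, of z] code[OF that, of y]
        z Z(1) \<open>y \<in> Y\<close> by auto
    with z(1) show ?thesis by blast
  qed
  with Z(1,2) show "\<exists>Z. finite Z \<and> Z \<subseteq> Y \<and> (\<forall>y\<in>Y. \<exists>z\<in>Z. \<forall>t\<in>T. dist (k t z) (k t y) \<le> e)"
    by blast
qed

lemma uniformly_totally_bounded_on_transpose:
  assumes family: "uniformly_totally_bounded_on Y k X"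
    and images: "\<And>x. x \<in> X \<Longrightarrow> totally_bounded (k x ` Y)"
  shows "uniformly_totally_bounded_on X (\<lambda>y x. k x y) Y"
  unfolding uniformly_totally_bounded_on_def
proof (intro allI impI)
  fix e :: real assume "0 < e"
  then have "0 < e / 3" by simp
  with family obtain T where T: "finite T" "T \<subseteq> X"
    and net: "\<forall>x\<in>X. \<exists>t\<in>T. \<forall>y\<in>Y. dist (k t y) (k x y) \<le> e / 3"
    unfolding uniformly_totally_bounded_on_def by metis
  have "uniformly_totally_bounded_on T (\<lambda>y t. k t y) Y"
    using T images by (intro uniformly_totally_bounded_on_finite) auto
  with \<open>0 < e / 3\<close> obtain Z where Z: "finite Z" "Z \<subseteq> Y"
    and close: "\<forall>y\<in>Y. \<exists>z\<in>Z. \<forall>t\<in>T. dist (k t z) (k t y) \<le> e / 3"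
    unfolding uniformly_totally_bounded_on_def by metis
  have "\<exists>z\<in>Z. \<forall>x\<in>X. dist (k x z) (k x y) \<le> e" if "y \<in> Y" for y
  proof -
    from close[rule_format, OF that]
    obtain z where z: "z \<in> Z" "\<forall>t\<in>T. dist (k t z) (k t y) \<le> e / 3" ..
    have "dist (k x z) (k x y) \<le> e" if "x \<in> X" for x
    proof -
      from net[rule_format, OF that]
      obtain t where t: "t \<in> T" "\<forall>y\<in>Y. dist (k t y) (k x y) \<le> e / 3" ..
      have "dist (k x z) (k x y) \<le> dist (k t z) (k x z) + dist (k t z) (k x y)"
        "dist (k t z) (k x y) \<le> dist (k t z) (k t y) + dist (k t y) (k x y)"
        by (rule dist_triangle3 dist_triangle)+
      moreover have "dist (k t z) (k x z) \<le> e / 3" "dist (k t y) (k x y) \<le> e / 3"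
        using t(2) \<open>y \<in> Y\<close> z(1) Z(2) by blast+
      moreover have "dist (k t z) (k t y) \<le> e / 3" using z(2) t(1) by blast
      ultimately show ?thesis by simp
    qed
    with z(1) show ?thesis by blast
  qed
  with Z show "\<exists>Z. finite Z \<and> Z \<subseteq> Y \<and> (\<forall>y\<in>Y. \<exists>z\<in>Z. \<forall>x\<in>X. dist (k x z) (k x y) \<le> e)"
    by blast
qed

section \<open>Lipschitz functions vanishing at the base point\<close>

lemma lipschitz_on_mult_const:
  fixes g :: "'a::metric_space \<Rightarrow> 'k::real_normed_algebra"
  assumes "C-lipschitz_on X g"
  shows "(norm c * C)-lipschitz_on X (\<lambda>x. c * g x)"
proof (rule lipschitz_onI)
  fix x y assume "x \<in> X" "y \<in> X"
  have "dist (c * g x) (c * g y) \<le> norm c * dist (g x) (g y)"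
    by (simp add: dist_norm norm_mult_ineq flip: right_diff_distrib)
  also have "\<dots> \<le> norm c * (C * dist x y)"
    using lipschitz_onD[OF assms \<open>x \<in> X\<close> \<open>y \<in> X\<close>] by (intro mult_left_mono) auto
  finally show "dist (c * g x) (c * g y) \<le> norm c * C * dist x y" by (simp add: mult.assoc)
qed (use lipschitz_on_nonneg[OF assms] in simp)

lemma lip0_iff_lipschitz: "g \<in> lip0 z \<longleftrightarrow> g z = 0 \<and> (\<exists>C. C-lipschitz_on UNIV g)"
proof -
  have "(max C 0)-lipschitz_on UNIV g" if "\<forall>x y. norm (g x - g y) \<le> C * dist x y" for C
  proof (rule lipschitz_onI)
    show "dist (g x) (g y) \<le> max C 0 * dist x y" for x y
      using order_trans[OF that[rule_format, of x y] mult_right_mono[of C "max C 0" "dist x y"]]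
      by (simp add: dist_norm)
  qed simp
  moreover have "norm (g x - g y) \<le> C * dist x y" if "C-lipschitz_on UNIV g" for C x y
    using lipschitz_onD[OF that, of x y] by (simp add: dist_norm)
  ultimately show ?thesis unfolding lip0_def by blast
qed

lemma lip0_ball_iff_lipschitz: "g \<in> lip0_ball z \<longleftrightarrow> g z = 0 \<and> 1-lipschitz_on UNIV g"
  unfolding lip0_ball_def lip0_def by (auto simp: lipschitz_on_def dist_norm intro: exI[of _ 1])

lemma lip0_ball_imp_lip0: "g \<in> lip0_ball z \<Longrightarrow> g \<in> lip0 z"
  by (simp add: lip0_ball_def)

lemma lip0_ball_dist_le: "g \<in> lip0_ball z \<Longrightarrow> dist (g x) (g y) \<le> dist x y"
  by (simp add: lip0_ball_def dist_norm)

lemma zero_in_lip0_ball: "(\<lambda>x. 0) \<in> lip0_ball z"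
  by (simp add: lip0_ball_iff_lipschitz lipschitz_on_def)

lemma lip0_add: "g \<in> lip0 z \<Longrightarrow> h \<in> lip0 z \<Longrightarrow> (\<lambda>x. g x + h x) \<in> lip0 z"
  by (auto simp: lip0_iff_lipschitz intro: lipschitz_on_add)

lemma lip0_mult: "g \<in> lip0 z \<Longrightarrow> (\<lambda>x. c * g x) \<in> lip0 z"
  by (auto simp: lip0_iff_lipschitz intro: lipschitz_on_mult_const)

lemma lip0_rescale_to_ball:
  fixes g :: "'a::metric_space \<Rightarrow> 'k::real_normed_field"
  assumes "g z = 0" "L-lipschitz_on UNIV g" "0 < L"
  shows "(\<lambda>x. of_real (1 / L) * g x) \<in> lip0_ball z"
  using assms lipschitz_on_mult_const[OF assms(2), of "of_real (1 / L)"]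
  by (simp add: lip0_ball_iff_lipschitz norm_divide)

lemma lip0_eq_mult_ball:
  fixes g :: "'a::metric_space \<Rightarrow> 'k::real_normed_field"
  assumes "g \<in> lip0 z"
  obtains c h where "h \<in> lip0_ball z" "g = (\<lambda>x. c * h x)"
proof -
  obtain C where C: "g z = 0" "C-lipschitz_on UNIV g"
    using assms by (auto simp: lip0_iff_lipschitz)
  define L where "L = C + 1"
  have L: "0 < L" "L-lipschitz_on UNIV g"
    using lipschitz_on_nonneg[OF C(2)] lipschitz_on_mono[OF C(2) subset_refl] by (simp_all add: L_def)
  then have "(\<lambda>x. of_real (1 / L) * g x) \<in> lip0_ball z"
    using C(1) lip0_rescale_to_ball by blast
  moreover have "g = (\<lambda>x. of_real L * (of_real (1 / L) * g x))"
    using L(1) by simp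
  ultimately show thesis using that by blast
qed

lemma lip0_compose:
  assumes "C-lipschitz_on UNIV f" "f zM = zN" "g \<in> lip0 zN"
  shows "g \<circ> f \<in> lip0 zM"
proof -
  obtain D where "D-lipschitz_on UNIV g" using assms(3) by (auto simp: lip0_iff_lipschitz)
  then have "D-lipschitz_on (range f) g" by (rule lipschitz_on_subset) simp
  then have "(D * C)-lipschitz_on UNIV (g \<circ> f)" by (rule lipschitz_on_compose[OF assms(1)])
  then show ?thesis using assms by (auto simp: lip0_iff_lipschitz)
qed

section \<open>The dual of the Lipschitz space\<close>

lemma bounded_lip0_dual: "\<Phi> \<in> lip0_dual z \<Longrightarrow> bounded (\<Phi> ` lip0_ball z)"
  by (auto simp: lip0_dual_def bounded_iff)

lemma lip0_dualI:
  assumes "\<And>g h. g \<in> lip0 z \<Longrightarrow> h \<in> lip0 z \<Longrightarrow> \<Phi> (\<lambda>x. g x + h x) = \<Phi> g + \<Phi> h"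
    and "\<And>c g. g \<in> lip0 z \<Longrightarrow> \<Phi> (\<lambda>x. c * g x) = c * \<Phi> g"
    and "bounded (\<Phi> ` lip0_ball z)"
    and "\<And>g. g \<notin> lip0 z \<Longrightarrow> \<Phi> g = 0"
  shows "\<Phi> \<in> lip0_dual z"
  using assms by (simp add: lip0_dual_def bounded_iff)

lemma lip0_dual_apply_mult: "\<Phi> \<in> lip0_dual z \<Longrightarrow> g \<in> lip0 z \<Longrightarrow> \<Phi> (\<lambda>x. c * g x) = c * \<Phi> g"
  by (simp add: lip0_dual_def)

lemma lip0_dual_apply_add:
  "\<Phi> \<in> lip0_dual z \<Longrightarrow> g \<in> lip0 z \<Longrightarrow> h \<in> lip0 z \<Longrightarrow> \<Phi> (\<lambda>x. g x + h x) = \<Phi> g + \<Phi> h"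
  by (simp add: lip0_dual_def)

lemma lip0_dual_apply_notin: "\<Phi> \<in> lip0_dual z \<Longrightarrow> g \<notin> lip0 z \<Longrightarrow> \<Phi> g = 0"
  by (simp add: lip0_dual_def)

lemma lip0_dual_apply_diff:
  assumes "\<Phi> \<in> lip0_dual z" "g \<in> lip0 z" "h \<in> lip0 z"
  shows "\<Phi> (\<lambda>x. g x - h x) = \<Phi> g - \<Phi> h"
  using lip0_dual_apply_add[OF assms(1,2) lip0_mult[OF assms(3)], of "-1"]
    lip0_dual_apply_mult[OF assms(1,3), of "-1"] by simp

lemma lip0_dual_add:
  assumes "\<Phi> \<in> lip0_dual z" "\<Psi> \<in> lip0_dual z"
  shows "(\<lambda>g. \<Phi> g + \<Psi> g) \<in> lip0_dual z"
proof (rule lip0_dualI)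
  show "bounded ((\<lambda>g. \<Phi> g + \<Psi> g) ` lip0_ball z)"
    using assms by (intro bounded_plus_comp bounded_lip0_dual)
qed (simp_all add: assms[THEN lip0_dual_apply_add] assms[THEN lip0_dual_apply_mult]
    assms[THEN lip0_dual_apply_notin] distrib_left)

lemma lip0_dual_mult:
  assumes "\<Phi> \<in> lip0_dual z"
  shows "(\<lambda>g. c * \<Phi> g) \<in> lip0_dual z"
proof (rule lip0_dualI)
  show "bounded ((\<lambda>g. c * \<Phi> g) ` lip0_ball z)"
    using bounded_linear_image[OF bounded_lip0_dual[OF assms] bounded_linear_mult_right[of c]]
    by (simp add: image_image)
qed (simp_all add: lip0_dual_apply_add[OF assms] lip0_dual_apply_mult[OF assms]
    lip0_dual_apply_notin[OF assms] distrib_left mult.left_commute)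

lemma lip0_dual_diff: "\<Phi> \<in> lip0_dual z \<Longrightarrow> \<Psi> \<in> lip0_dual z \<Longrightarrow> (\<lambda>g. \<Phi> g - \<Psi> g) \<in> lip0_dual z"
  using lip0_dual_add[OF _ lip0_dual_mult[of \<Psi> z "-1"], of \<Phi>] by simp

lemma evalf_in_lip0_dual: "evalf z p \<in> lip0_dual z"
proof (rule lip0_dualI)
  have "norm (g p) \<le> dist p z" if "g \<in> lip0_ball z" for g :: "'a \<Rightarrow> 'b"
    using lip0_ball_dist_le[OF that, of p z] that by (simp add: lip0_ball_iff_lipschitz)
  then show "bounded ((evalf z p :: ('a \<Rightarrow> 'b) \<Rightarrow> 'b) ` lip0_ball z)"
    by (auto simp: bounded_iff evalf_def lip0_ball_imp_lip0)
qed (simp_all add: evalf_def lip0_add lip0_mult)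

lemma evalf_combination_in_lip0_dual: "(\<lambda>g. \<Sum>p\<in>P. a p * evalf z p g) \<in> lip0_dual z"
proof (induction P rule: infinite_finite_induct)
  case (insert p P)
  then show ?case
    using lip0_dual_add[OF lip0_dual_mult[OF evalf_in_lip0_dual]] by simp
qed (auto simp: lip0_dual_def)

lemma le_dual_norm:
  assumes "\<Phi> \<in> lip0_dual z" "g \<in> lip0_ball z"
  shows "norm (\<Phi> g) \<le> dual_norm z \<Phi>"
  unfolding dual_norm_def
  using bounded_lip0_dual[OF assms(1)] assms(2)
  by (intro cSUP_upper bounded_imp_bdd_above) (simp_all add: bounded_norm_comp)

lemma dual_norm_le:
  assumes "\<And>g. g \<in> lip0_ball z \<Longrightarrow> norm (\<Phi> g) \<le> C"
  shows "dual_norm z \<Phi> \<le> C"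
  unfolding dual_norm_def using assms zero_in_lip0_ball by (intro cSUP_least) auto

lemma dual_norm_nonneg: "\<Phi> \<in> lip0_dual z \<Longrightarrow> 0 \<le> dual_norm z \<Phi>"
  using le_dual_norm[OF _ zero_in_lip0_ball] norm_ge_zero order_trans by blast

lemma norm_apply_le_dual_norm:
  fixes g :: "'a::metric_space \<Rightarrow> 'k::real_normed_field"
  assumes \<Phi>: "\<Phi> \<in> lip0_dual z" and g: "g z = 0" "L-lipschitz_on UNIV g"
  shows "norm (\<Phi> g) \<le> L * dual_norm z \<Phi>"
proof (cases "L = 0")
  case True
  have "g x = 0" for x
    using lipschitz_onD[OF g(2), of x z] g(1) True by simp
  then have "g = (\<lambda>x. 0 * g x)" by (simp add: fun_eq_iff)
  moreover have "g \<in> lip0 z" using g by (auto simp: lip0_iff_lipschitz)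
  ultimately have "\<Phi> g = 0 * \<Phi> g" using lip0_dual_apply_mult[OF \<Phi>] by metis
  then show ?thesis using True by simp
next
  case False
  then have "0 < L" using lipschitz_on_nonneg[OF g(2)] by simp
  have "g \<in> lip0 z" using g by (auto simp: lip0_iff_lipschitz)
  then have "of_real (1 / L) * \<Phi> g = \<Phi> (\<lambda>x. of_real (1 / L) * g x)"
    by (rule lip0_dual_apply_mult[OF \<Phi>, symmetric])
  then have "norm (of_real (1 / L) * \<Phi> g) \<le> dual_norm z \<Phi>"
    using le_dual_norm[OF \<Phi> lip0_rescale_to_ball[OF g \<open>0 < L\<close>]] by simp
  then show ?thesis using \<open>0 < L\<close> by (simp add: norm_mult norm_divide field_simps)
qed

lemma dual_norm_diff_tendsto_0_iff:
  assumes "\<And>n. \<phi> n \<in> lip0_dual z" "\<Psi> \<in> lip0_dual z"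
  shows "((\<lambda>n. dual_norm z (\<lambda>g. \<phi> n g - \<Psi> g)) \<longlongrightarrow> 0) F \<longleftrightarrow> uniform_limit (lip0_ball z) \<phi> \<Psi> F"
proof
  have diff: "(\<lambda>g. \<phi> n g - \<Psi> g) \<in> lip0_dual z" for n
    using assms by (intro lip0_dual_diff)
  show "uniform_limit (lip0_ball z) \<phi> \<Psi> F"
    if "((\<lambda>n. dual_norm z (\<lambda>g. \<phi> n g - \<Psi> g)) \<longlongrightarrow> 0) F"
  proof (rule uniform_limitI)
    fix e :: real assume "0 < e"
    with that have "\<forall>\<^sub>F n in F. dual_norm z (\<lambda>g. \<phi> n g - \<Psi> g) < e" by (rule order_tendstoD)
    then show "\<forall>\<^sub>F n in F. \<forall>g\<in>lip0_ball z. dist (\<phi> n g) (\<Psi> g) < e"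
      using le_dual_norm[OF diff]
      by (auto simp: dist_norm elim!: eventually_mono intro: le_less_trans)
  qed
  show "((\<lambda>n. dual_norm z (\<lambda>g. \<phi> n g - \<Psi> g)) \<longlongrightarrow> 0) F" if unif: "uniform_limit (lip0_ball z) \<phi> \<Psi> F"
  proof (rule tendstoI)
    fix e :: real assume "0 < e"
    then have "\<forall>\<^sub>F n in F. \<forall>g\<in>lip0_ball z. dist (\<phi> n g) (\<Psi> g) < e / 2"
      by (intro uniform_limitD[OF unif]) simp
    then show "\<forall>\<^sub>F n in F. dist (dual_norm z (\<lambda>g. \<phi> n g - \<Psi> g)) 0 < e"
    proof (rule eventually_mono)
      fix n assume "\<forall>g\<in>lip0_ball z. dist (\<phi> n g) (\<Psi> g) < e / 2"
      then have "dual_norm z (\<lambda>g. \<phi> n g - \<Psi> g) \<le> e / 2"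
        by (intro dual_norm_le) (simp add: dist_norm less_imp_le)
      then show "dist (dual_norm z (\<lambda>g. \<phi> n g - \<Psi> g)) 0 < e"
        using dual_norm_nonneg[OF diff] \<open>0 < e\<close> by simp
    qed
  qed
qed

lemma lip0_dual_uniformly_Cauchy_imp_convergent:
  fixes \<phi> :: "nat \<Rightarrow> ('a::metric_space \<Rightarrow> 'k::{real_normed_field,complete_space}) \<Rightarrow> 'k"
  assumes \<phi>: "\<And>n. \<phi> n \<in> lip0_dual z" and Cauchy: "uniformly_Cauchy_on (lip0_ball z) \<phi>"
  shows "convergent (\<lambda>n. \<phi> n g)"
proof (cases "g \<in> lip0 z")
  case True
  then obtain c h where h: "h \<in> lip0_ball z" and g: "g = (\<lambda>x. c * h x)" by (rule lip0_eq_mult_ball)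
  have "convergent (\<lambda>n. \<phi> n h)"
    using uniformly_Cauchy_imp_Cauchy[OF Cauchy h] by (rule Cauchy_convergent)
  then have "convergent (\<lambda>n. c * \<phi> n h)" by (intro convergent_mult convergent_const)
  then show ?thesis
    unfolding g lip0_dual_apply_mult[OF \<phi> lip0_ball_imp_lip0[OF h]] .
next
  case False
  then show ?thesis using lip0_dual_apply_notin[OF \<phi>] by (simp add: convergent_const)
qed

lemma lip0_dual_pointwise_limit:
  fixes \<phi> :: "nat \<Rightarrow> ('a::metric_space \<Rightarrow> 'k::real_normed_field) \<Rightarrow> 'k"
  assumes \<phi>: "\<And>n. \<phi> n \<in> lip0_dual z" and lim: "\<And>g. (\<lambda>n. \<phi> n g) \<longlonglongrightarrow> \<Psi> g"
    and bdd: "bounded (\<Psi> ` lip0_ball z)"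
  shows "\<Psi> \<in> lip0_dual z"
proof (rule lip0_dualI[OF _ _ bdd])
  fix g h :: "'a \<Rightarrow> 'k" assume "g \<in> lip0 z" "h \<in> lip0 z"
  then have "(\<lambda>n. \<phi> n g + \<phi> n h) \<longlonglongrightarrow> \<Psi> (\<lambda>x. g x + h x)"
    using lim[of "\<lambda>x. g x + h x"] by (simp add: lip0_dual_apply_add[OF \<phi>])
  then show "\<Psi> (\<lambda>x. g x + h x) = \<Psi> g + \<Psi> h"
    using tendsto_add[OF lim lim] by (rule LIMSEQ_unique)
next
  fix c and g :: "'a \<Rightarrow> 'k" assume "g \<in> lip0 z"
  then have "(\<lambda>n. c * \<phi> n g) \<longlonglongrightarrow> \<Psi> (\<lambda>x. c * g x)"
    using lim[of "\<lambda>x. c * g x"] by (simp add: lip0_dual_apply_mult[OF \<phi>])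
  then show "\<Psi> (\<lambda>x. c * g x) = c * \<Psi> g"
    using tendsto_mult_left[OF lim] by (rule LIMSEQ_unique)
next
  show "\<Psi> g = 0" if "g \<notin> lip0 z" for g
    using lim[of g] that by (simp add: lip0_dual_apply_notin[OF \<phi>] LIMSEQ_const_iff)
qed

lemma lip0_dual_complete:
  fixes \<phi> :: "nat \<Rightarrow> ('a::metric_space \<Rightarrow> 'k::{real_normed_field,complete_space}) \<Rightarrow> 'k"
  assumes \<phi>: "\<And>n. \<phi> n \<in> lip0_dual z" and Cauchy: "uniformly_Cauchy_on (lip0_ball z) \<phi>"
  obtains \<Psi> where "\<Psi> \<in> lip0_dual z" "uniform_limit (lip0_ball z) \<phi> \<Psi> sequentially"
proof -
  define \<Psi> where "\<Psi> g = lim (\<lambda>n. \<phi> n g)" for g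
  have lim: "(\<lambda>n. \<phi> n g) \<longlonglongrightarrow> \<Psi> g" for g
    using lip0_dual_uniformly_Cauchy_imp_convergent[OF \<phi> Cauchy]
    by (simp add: \<Psi>_def convergent_LIMSEQ_iff)
  obtain l where l: "uniform_limit (lip0_ball z) \<phi> l sequentially"
    using Cauchy_uniformly_convergent[OF Cauchy] by (auto simp: uniformly_convergent_on_def)
  have "l g = \<Psi> g" if "g \<in> lip0_ball z" for g
    using tendsto_uniform_limitI[OF l that] lim by (rule LIMSEQ_unique)
  then have unif: "uniform_limit (lip0_ball z) \<phi> \<Psi> sequentially"
    using l by (simp cong: uniform_limit_cong')
  then have "bounded (\<Psi> ` lip0_ball z)"
    by (rule uniform_limit_bounded) (simp_all add: bounded_lip0_dual[OF \<phi>])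
  with \<phi> lim have "\<Psi> \<in> lip0_dual z" by (rule lip0_dual_pointwise_limit)
  then show thesis using that unif by blast
qed

section \<open>The Lipschitz-free space\<close>

lemma free_space_imp_lip0_dual: "\<Phi> \<in> free_space z \<Longrightarrow> \<Phi> \<in> lip0_dual z"
  by (simp add: free_space_def)

lemma free_space_approx:
  assumes "\<Phi> \<in> free_space z" "0 < e"
  obtains P a where "finite P" "dual_norm z (\<lambda>g. \<Phi> g - (\<Sum>p\<in>P. a p * evalf z p g)) < e"
  using assms unfolding free_space_def by blast

lemma free_spaceI:
  assumes "\<Phi> \<in> lip0_dual z"
    and "\<And>e. 0 < e \<Longrightarrow> \<exists>P a. finite P \<and> dual_norm z (\<lambda>g. \<Phi> g - (\<Sum>p\<in>P. a p * evalf z p g)) < e"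
  shows "\<Phi> \<in> free_space z"
  unfolding free_space_def using assms by simp

lemma evalf_combination_in_free_space:
  assumes "finite P"
  shows "(\<lambda>g. \<Sum>p\<in>P. a p * evalf z p g) \<in> free_space z"
proof (rule free_spaceI)
  fix e :: real assume "0 < e"
  have "dual_norm z (\<lambda>g. (\<Sum>p\<in>P. a p * evalf z p g) - (\<Sum>p\<in>P. a p * evalf z p g)) \<le> 0"
    by (rule dual_norm_le) simp
  also note \<open>0 < e\<close>
  finally show "\<exists>Q b. finite Q \<and>
      dual_norm z (\<lambda>g. (\<Sum>p\<in>P. a p * evalf z p g) - (\<Sum>p\<in>Q. b p * evalf z p g)) < e"
    using assms by blast
qed (rule evalf_combination_in_lip0_dual)

lemma free_space_closed:
  fixes \<phi> :: "nat \<Rightarrow> ('a::metric_space \<Rightarrow> 'k::real_normed_field) \<Rightarrow> 'k"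
  assumes \<phi>: "\<And>n. \<phi> n \<in> free_space z" and \<Psi>: "\<Psi> \<in> lip0_dual z"
    and lim: "uniform_limit (lip0_ball z) \<phi> \<Psi> sequentially"
  shows "\<Psi> \<in> free_space z"
proof (rule free_spaceI[OF \<Psi>])
  fix e :: real assume "0 < e"
  then have "0 < e / 3" by simp
  obtain n where n: "\<forall>g\<in>lip0_ball z. dist (\<phi> n g) (\<Psi> g) < e / 3"
    using uniform_limitD[OF lim \<open>0 < e / 3\<close>] by (auto simp: eventually_sequentially)
  obtain P a where P: "finite P"
    and a: "dual_norm z (\<lambda>g. \<phi> n g - (\<Sum>p\<in>P. a p * evalf z p g)) < e / 3"
    by (rule free_space_approx[OF \<phi> \<open>0 < e / 3\<close>])
  have "dual_norm z (\<lambda>g. \<Psi> g - (\<Sum>p\<in>P. a p * evalf z p g)) \<le> e / 3 + e / 3"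
  proof (rule dual_norm_le)
    fix g :: "'a \<Rightarrow> 'k" assume g: "g \<in> lip0_ball z"
    have "(\<lambda>g. \<phi> n g - (\<Sum>p\<in>P. a p * evalf z p g)) \<in> lip0_dual z"
      using free_space_imp_lip0_dual[OF \<phi>] evalf_combination_in_lip0_dual by (rule lip0_dual_diff)
    from le_dual_norm[OF this g] a have "norm (\<phi> n g - (\<Sum>p\<in>P. a p * evalf z p g)) \<le> e / 3"
      by (rule order_trans[OF _ less_imp_le])
    moreover have "norm (\<Psi> g - \<phi> n g) \<le> e / 3"
      using n g by (simp add: dist_norm norm_minus_commute less_imp_le)
    ultimately show "norm (\<Psi> g - (\<Sum>p\<in>P. a p * evalf z p g)) \<le> e / 3 + e / 3"
      by (rule norm_diff_triangle_le[rotated])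
  qed
  also have "\<dots> < e" using \<open>0 < e\<close> by simp
  finally show "\<exists>P a. finite P \<and> dual_norm z (\<lambda>g. \<Psi> g - (\<Sum>p\<in>P. a p * evalf z p g)) < e"
    using P by blast
qed

definition molecule :: "'a::metric_space \<Rightarrow> 'a \<Rightarrow> 'a \<Rightarrow> ('a \<Rightarrow> 'k::real_normed_field) \<Rightarrow> 'k" where
  "molecule z x y g = (evalf z x g - evalf z y g) / of_real (dist x y)"

lemma molecule_in_free_space: "molecule z x y \<in> free_space z"
proof (cases "x = y")
  case True
  then show ?thesis
    using evalf_combination_in_free_space[of "{}"] by (simp add: molecule_def[abs_def])
next
  case False
  define a :: "'a \<Rightarrow> 'b" where "a p = (if p = x then 1 else - 1) / of_real (dist x y)" for p
  have "molecule z x y = (\<lambda>g. \<Sum>p\<in>{x, y}. a p * evalf z p g)"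
    using False by (auto simp: molecule_def a_def diff_divide_distrib)
  then show ?thesis using evalf_combination_in_free_space[of "{x, y}" a] by simp
qed

lemma dual_norm_molecule_le: "dual_norm z (molecule z x y) \<le> 1"
  using lip0_ball_dist_le
  by (intro dual_norm_le)
    (auto simp: molecule_def evalf_def lip0_ball_imp_lip0 norm_divide divide_le_eq_1
      simp flip: dist_norm)
section \<open>Slopes\<close>

text \<open>On the diagonal, division by zero makes slopes and dilations vanish, so pairs need not be
  restricted to distinct points.\<close>

definition slope :: "('a::metric_space \<Rightarrow> 'b) \<Rightarrow> 'a \<Rightarrow> 'a \<Rightarrow> ('b \<Rightarrow> 'k::real_normed_field) \<Rightarrow> 'k" where
  "slope f x y g = (g (f x) - g (f y)) / of_real (dist x y)"

definition dilation :: "('a::metric_space \<Rightarrow> 'b::metric_space) \<Rightarrow> 'a \<Rightarrow> 'a \<Rightarrow> real" where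
  "dilation f x y = dist (f x) (f y) / dist x y"

definition precompact_slopes ::
    "'k::real_normed_field itself \<Rightarrow> 'b::metric_space \<Rightarrow> ('a::metric_space \<Rightarrow> 'b) \<Rightarrow> bool" where
  "precompact_slopes _ z f \<longleftrightarrow> uniformly_totally_bounded_on
    (lip0_ball z :: ('b \<Rightarrow> 'k) set) (\<lambda>p. slope f (fst p) (snd p)) UNIV"

lemma norm_slope_le_dilation: "g \<in> lip0_ball z \<Longrightarrow> norm (slope f x y g) \<le> dilation f x y"
  using lip0_ball_dist_le[of g z "f x" "f y"]
  by (simp add: slope_def dilation_def norm_divide divide_right_mono flip: dist_norm)

lemma dilation_nonneg: "0 \<le> dilation f x y"
  by (simp add: dilation_def)

lemma dilation_commute: "dilation f x y = dilation f y x"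
  by (simp add: dilation_def dist_commute)

lemma dilation_le: "C-lipschitz_on UNIV f \<Longrightarrow> dilation f x y \<le> C"
  using lipschitz_onD[of C UNIV f x y] lipschitz_on_nonneg[of C UNIV f]
  by (cases "x = y") (simp_all add: dilation_def divide_le_eq)

lemma le_dilation_iff:
  assumes "0 < c"
  shows "c \<le> dilation f x y \<longleftrightarrow> x \<noteq> y \<and> c * dist x y \<le> dist (f x) (f y)"
  using assms by (cases "x = y") (simp_all add: dilation_def le_divide_eq)

lemma precompact_slopes_Cauchy_subseq:
  assumes "precompact_slopes TYPE('k::real_normed_field) z f"
  obtains r :: "nat \<Rightarrow> nat" where "strict_mono r"
    "uniformly_Cauchy_on (lip0_ball z :: ('b::metric_space \<Rightarrow> 'k) set)
      (\<lambda>n. slope f (xs (r n)) (ys (r n)))"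
  using uniformly_totally_bounded_on_Cauchy_subseq
    [OF assms[unfolded precompact_slopes_def], of "\<lambda>n. (xs n, ys n)"]
  by auto

lemma precompact_slopesI:
  fixes f :: "'a::metric_space \<Rightarrow> 'b::metric_space"
  assumes "\<And>xs ys :: nat \<Rightarrow> 'a. \<exists>r. strict_mono r \<and>
      uniformly_Cauchy_on (lip0_ball z :: ('b \<Rightarrow> 'k) set) (\<lambda>n. slope f (xs (r n)) (ys (r n)))"
  shows "precompact_slopes TYPE('k::real_normed_field) z f"
  unfolding precompact_slopes_def
proof (rule uniformly_totally_bounded_onI)
  fix s :: "nat \<Rightarrow> 'a \<times> 'a"
  show "\<exists>r. strict_mono r \<and>
      uniformly_Cauchy_on (lip0_ball z :: ('b \<Rightarrow> 'k) set)
        (\<lambda>n. slope f (fst (s (r n))) (snd (s (r n))))"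
    by (rule assms)
qed

section \<open>Compactness of the operator and precompactness of the slopes\<close>

locale pointed_lipschitz =
  fixes f :: "'a::metric_space \<Rightarrow> 'b::metric_space" and zM :: 'a and zN :: 'b and C :: real
  assumes lipschitz: "C-lipschitz_on UNIV f" and base: "f zM = zN"
begin

lemma C_nonneg: "0 \<le> C"
  by (rule lipschitz_on_nonneg[OF lipschitz])

lemmas compose_in_lip0 = lip0_compose[OF lipschitz base]

lemma norm_apply_compose_le:
  fixes \<Phi> :: "('a \<Rightarrow> 'k::real_normed_field) \<Rightarrow> 'k"
  assumes "\<Phi> \<in> lip0_dual zM" "g \<in> lip0_ball zN"
  shows "norm (\<Phi> (g \<circ> f)) \<le> C * dual_norm zM \<Phi>"
proof (rule norm_apply_le_dual_norm[OF assms(1)])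
  have "1-lipschitz_on UNIV g"
    using assms(2) by (simp add: lip0_ball_iff_lipschitz)
  then have "1-lipschitz_on (range f) g" by (rule lipschitz_on_subset) simp
  then show "C-lipschitz_on UNIV (g \<circ> f)"
    using lipschitz_on_compose[OF lipschitz, of 1 g] by simp
qed (use assms(2) base in \<open>simp add: lip0_ball_iff_lipschitz\<close>)

lemma free_lift_apply_ball: "g \<in> lip0_ball zN \<Longrightarrow> free_lift zN f \<Phi> g = \<Phi> (g \<circ> f)"
  by (simp add: free_lift_def lip0_ball_imp_lip0)

lemma free_lift_in_lip0_dual:
  fixes \<Phi> :: "('a \<Rightarrow> 'k::real_normed_field) \<Rightarrow> 'k"
  assumes \<Phi>: "\<Phi> \<in> lip0_dual zM"
  shows "free_lift zN f \<Phi> \<in> lip0_dual zN"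
proof (rule lip0_dualI)
  fix g h :: "'b \<Rightarrow> 'k" assume g: "g \<in> lip0 zN" and h: "h \<in> lip0 zN"
  then show "free_lift zN f \<Phi> (\<lambda>x. g x + h x) = free_lift zN f \<Phi> g + free_lift zN f \<Phi> h"
    using lip0_dual_apply_add[OF \<Phi> compose_in_lip0[OF g] compose_in_lip0[OF h]]
    by (simp add: free_lift_def lip0_add comp_def)
next
  fix c and g :: "'b \<Rightarrow> 'k" assume g: "g \<in> lip0 zN"
  then show "free_lift zN f \<Phi> (\<lambda>x. c * g x) = c * free_lift zN f \<Phi> g"
    using lip0_dual_apply_mult[OF \<Phi> compose_in_lip0[OF g]]
    by (simp add: free_lift_def lip0_mult comp_def)
next
  show "bounded (free_lift zN f \<Phi> ` lip0_ball zN)"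
    using norm_apply_compose_le[OF \<Phi>] by (auto simp: bounded_iff free_lift_apply_ball)
qed (simp add: free_lift_def)

lemma free_lift_evalf_combination:
  assumes "finite P" "g \<in> lip0 zN"
  shows "free_lift zN f (\<lambda>g. \<Sum>p\<in>P. a p * evalf zM p g) g =
    (\<Sum>q\<in>f ` P. (\<Sum>p\<in>{p \<in> P. f p = q}. a p) * evalf zN q g)"
proof -
  have "free_lift zN f (\<lambda>g. \<Sum>p\<in>P. a p * evalf zM p g) g = (\<Sum>p\<in>P. a p * g (f p))"
    using assms(2) by (simp add: free_lift_def evalf_def compose_in_lip0)
  also have "\<dots> = (\<Sum>q\<in>f ` P. \<Sum>p\<in>{p \<in> P. f p = q}. a p * g (f p))"
    by (rule sum.image_gen[OF assms(1)])
  also have "\<dots> = (\<Sum>q\<in>f ` P. (\<Sum>p\<in>{p \<in> P. f p = q}. a p) * evalf zN q g)"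
    using assms(2) by (auto simp: evalf_def sum_distrib_right intro!: sum.cong)
  finally show ?thesis .
qed

lemma free_lift_in_free_space:
  fixes \<Phi> :: "('a \<Rightarrow> 'k::real_normed_field) \<Rightarrow> 'k"
  assumes \<Phi>: "\<Phi> \<in> free_space zM"
  shows "free_lift zN f \<Phi> \<in> free_space zN"
proof (rule free_spaceI)
  show "free_lift zN f \<Phi> \<in> lip0_dual zN"
    using \<Phi> by (intro free_lift_in_lip0_dual free_space_imp_lip0_dual)
next
  fix e :: real assume "0 < e"
  then have "0 < e / (C + 1)" using C_nonneg by simp
  with \<Phi> obtain P a where P: "finite P"
    and approx: "dual_norm zM (\<lambda>g. \<Phi> g - (\<Sum>p\<in>P. a p * evalf zM p g)) < e / (C + 1)"
    by (rule free_space_approx)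
  define \<Delta> where "\<Delta> g = \<Phi> g - (\<Sum>p\<in>P. a p * evalf zM p g)" for g
  define b where "b q = (\<Sum>p\<in>{p \<in> P. f p = q}. a p)" for q
  have \<Delta>: "\<Delta> \<in> lip0_dual zM"
    unfolding \<Delta>_def[abs_def]
    using free_space_imp_lip0_dual[OF \<Phi>] evalf_combination_in_lip0_dual by (rule lip0_dual_diff)
  have "dual_norm zN (\<lambda>g. free_lift zN f \<Phi> g - (\<Sum>q\<in>f ` P. b q * evalf zN q g)) \<le> C * dual_norm zM \<Delta>"
  proof (rule dual_norm_le)
    fix g :: "'b \<Rightarrow> 'k" assume g: "g \<in> lip0_ball zN"
    have "free_lift zN f \<Phi> g - (\<Sum>q\<in>f ` P. b q * evalf zN q g) = \<Delta> (g \<circ> f)"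
      using free_lift_evalf_combination[OF P lip0_ball_imp_lip0[OF g], of a]
      by (simp add: free_lift_apply_ball[OF g] b_def \<Delta>_def)
    then show "norm (free_lift zN f \<Phi> g - (\<Sum>q\<in>f ` P. b q * evalf zN q g)) \<le> C * dual_norm zM \<Delta>"
      using norm_apply_compose_le[OF \<Delta> g] by simp
  qed
  also have "\<dots> \<le> (C + 1) * dual_norm zM \<Delta>"
    using dual_norm_nonneg[OF \<Delta>] by (intro mult_right_mono) auto
  also have "\<dots> < e"
    using approx C_nonneg by (simp add: \<Delta>_def[abs_def] less_divide_eq mult.commute)
  finally show "\<exists>Q b. finite Q \<and>
      dual_norm zN (\<lambda>g. free_lift zN f \<Phi> g - (\<Sum>q\<in>Q. b q * evalf zN q g)) < e"
    using P by blast
qed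

lemma free_lift_molecule:
  "g \<in> lip0_ball zN \<Longrightarrow> free_lift zN f (molecule zM x y) g = slope f x y g"
  by (simp add: free_lift_apply_ball molecule_def slope_def evalf_def compose_in_lip0
      lip0_ball_imp_lip0)

theorem free_lift_compact_imp_precompact_slopes:
  assumes compact: "free_lift_compact TYPE('k::real_normed_field) zM zN f"
  shows "precompact_slopes TYPE('k) zN f"
proof (rule precompact_slopesI)
  fix xs ys :: "nat \<Rightarrow> 'a"
  define m :: "nat \<Rightarrow> ('a \<Rightarrow> 'k) \<Rightarrow> 'k" where "m n = molecule zM (xs n) (ys n)" for n
  have "\<forall>n. m n \<in> free_space zM \<and> dual_norm zM (m n) \<le> 1"
    by (simp add: m_def molecule_in_free_space dual_norm_molecule_le)
  from compact[unfolded free_lift_compact_def, THEN spec, THEN mp, OF this]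
  obtain r \<Psi> where r: "strict_mono r" and \<Psi>: "\<Psi> \<in> free_space zN"
    and lim: "(\<lambda>n. dual_norm zN (\<lambda>g. free_lift zN f (m (r n)) g - \<Psi> g)) \<longlonglongrightarrow> 0"
    by (elim exE conjE)
  have "free_lift zN f (m n) \<in> lip0_dual zN" for n
    unfolding m_def by (intro free_lift_in_lip0_dual free_space_imp_lip0_dual molecule_in_free_space)
  then have "uniform_limit (lip0_ball zN) (\<lambda>n. free_lift zN f (m (r n))) \<Psi> sequentially"
    using lim \<Psi> by (simp add: dual_norm_diff_tendsto_0_iff free_space_imp_lip0_dual)
  then have "uniform_limit (lip0_ball zN) (\<lambda>n. slope f (xs (r n)) (ys (r n))) \<Psi> sequentially"
    by (simp add: m_def free_lift_molecule cong: uniform_limit_cong')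
  then have "uniformly_Cauchy_on (lip0_ball zN) (\<lambda>n. slope f (xs (r n)) (ys (r n)) :: ('b \<Rightarrow> 'k) \<Rightarrow> 'k)"
    by (intro uniformly_convergent_Cauchy) (auto simp: uniformly_convergent_on_def)
  with r show "\<exists>r. strict_mono r \<and>
      uniformly_Cauchy_on (lip0_ball zN :: ('b \<Rightarrow> 'k) set) (\<lambda>n. slope f (xs (r n)) (ys (r n)))"
    by blast
qed

lemma dist_apply_compose_le:
  fixes \<Phi> :: "('a \<Rightarrow> 'k::real_normed_field) \<Rightarrow> 'k"
  assumes \<Phi>: "\<Phi> \<in> lip0_dual zM" "dual_norm zM \<Phi> \<le> 1"
    and g: "g \<in> lip0_ball zN" and h: "h \<in> lip0_ball zN" and "0 \<le> e"
    and close: "\<And>x y. dist (slope f x y h) (slope f x y g) \<le> e"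
  shows "dist (\<Phi> (h \<circ> f)) (\<Phi> (g \<circ> f)) \<le> e"
proof -
  have hf: "h \<circ> f \<in> lip0 zM" and gf: "g \<circ> f \<in> lip0 zM"
    using g h by (auto intro: compose_in_lip0 lip0_ball_imp_lip0)
  define q where "q x = (h \<circ> f) x - (g \<circ> f) x" for x
  have "e-lipschitz_on UNIV q"
  proof (rule lipschitz_onI)
    fix x y
    have "slope f x y h - slope f x y g = (q x - q y) / of_real (dist x y)"
      by (simp add: slope_def q_def diff_divide_distrib)
    then show "dist (q x) (q y) \<le> e * dist x y"
      using close[of x y] by (cases "x = y") (simp_all add: dist_norm norm_divide divide_le_eq)
  qed fact
  moreover have "q zM = 0" using hf gf by (simp add: q_def lip0_def)
  ultimately have "norm (\<Phi> q) \<le> e * dual_norm zM \<Phi>"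
    by (intro norm_apply_le_dual_norm[OF \<Phi>(1)])
  also have "\<dots> \<le> e" using \<Phi>(2) \<open>0 \<le> e\<close> by (rule mult_left_le)
  finally show ?thesis
    using lip0_dual_apply_diff[OF \<Phi>(1) hf gf] by (simp add: dist_norm q_def[abs_def])
qed

lemma precompact_slopes_imp_uniformly_totally_bounded_dual:
  assumes "precompact_slopes TYPE('k::{real_normed_field,heine_borel}) zN f"
  shows "uniformly_totally_bounded_on (lip0_ball zN) (\<lambda>\<Phi> g. \<Phi> (g \<circ> f))
    {\<Phi> :: ('a \<Rightarrow> 'k) \<Rightarrow> 'k. \<Phi> \<in> lip0_dual zM \<and> dual_norm zM \<Phi> \<le> 1}"
    (is "uniformly_totally_bounded_on _ _ ?D")
proof (rule uniformly_totally_bounded_on_transpose)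
  have "norm (slope f x y g) \<le> C" if "g \<in> lip0_ball zN" for x y and g :: "'b \<Rightarrow> 'k"
    using norm_slope_le_dilation[OF that] dilation_le[OF lipschitz] by (rule order_trans)
  then have "totally_bounded ((slope f x y :: ('b \<Rightarrow> 'k) \<Rightarrow> 'k) ` lip0_ball zN)" for x y
    by (intro totally_bounded_if_bounded boundedI) auto
  then have slopes: "uniformly_totally_bounded_on UNIV
      (\<lambda>(g :: 'b \<Rightarrow> 'k) p. slope f (fst p) (snd p) g) (lip0_ball zN)"
    by (rule uniformly_totally_bounded_on_transpose[OF assms[unfolded precompact_slopes_def]])
  show "uniformly_totally_bounded_on ?D (\<lambda>g \<Phi>. \<Phi> (g \<circ> f)) (lip0_ball zN)"
    unfolding uniformly_totally_bounded_on_def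
  proof (intro allI impI)
    fix e :: real assume "0 < e"
    with slopes obtain G where G: "finite G" "G \<subseteq> lip0_ball zN"
      and net: "\<forall>g :: 'b \<Rightarrow> 'k \<in> lip0_ball zN. \<exists>h\<in>G. \<forall>x y. dist (slope f x y h) (slope f x y g) \<le> e"
      unfolding uniformly_totally_bounded_on_def ball_UNIV split_paired_All fst_conv snd_conv by metis
    have "\<exists>h\<in>G. \<forall>\<Phi>\<in>?D. dist (\<Phi> (h \<circ> f)) (\<Phi> (g \<circ> f)) \<le> e" if g: "g \<in> lip0_ball zN" for g :: "'b \<Rightarrow> 'k"
    proof -
      obtain h where "h \<in> G" "\<forall>x y. dist (slope f x y h) (slope f x y g) \<le> e"
        using net g by blast
      then show ?thesis
        using dist_apply_compose_le[OF _ _ g, of _ h e] G(2) \<open>0 < e\<close> by (intro bexI[of _ h]) auto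
    qed
    with G show "\<exists>G. finite G \<and> G \<subseteq> lip0_ball zN \<and>
        (\<forall>g\<in>lip0_ball zN. \<exists>h\<in>G. \<forall>\<Phi>\<in>?D. dist (\<Phi> (h \<circ> f)) (\<Phi> (g \<circ> f)) \<le> e)"
      by blast
  qed
next
  fix g :: "'b \<Rightarrow> 'k" assume g: "g \<in> lip0_ball zN"
  have "norm (\<Phi> (g \<circ> f)) \<le> C" if "\<Phi> \<in> ?D" for \<Phi>
    using norm_apply_compose_le[OF _ g, of \<Phi>] that C_nonneg
      mult_left_le[of "dual_norm zM \<Phi>" C] by auto
  then show "totally_bounded ((\<lambda>\<Phi>. \<Phi> (g \<circ> f)) ` ?D)"
    by (intro totally_bounded_if_bounded) (auto simp: bounded_iff)
qed

theorem free_lift_compact_iff_precompact_slopes: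
  "free_lift_compact TYPE('k::{real_normed_field,heine_borel}) zM zN f \<longleftrightarrow>
    precompact_slopes TYPE('k) zN f"
proof
  assume slopes: "precompact_slopes TYPE('k) zN f"
  show "free_lift_compact TYPE('k) zM zN f"
    unfolding free_lift_compact_def
  proof (intro allI impI)
    fix s :: "nat \<Rightarrow> ('a \<Rightarrow> 'k) \<Rightarrow> 'k"
    assume s: "\<forall>n. s n \<in> free_space zM \<and> dual_norm zM (s n) \<le> 1"
    then have "range s \<subseteq> {\<Phi> \<in> lip0_dual zM. dual_norm zM \<Phi> \<le> 1}"
      by (auto intro: free_space_imp_lip0_dual)
    with precompact_slopes_imp_uniformly_totally_bounded_dual[OF slopes]
    obtain r where r: "strict_mono r"
      and "uniformly_Cauchy_on (lip0_ball zN) (\<lambda>n g. s (r n) (g \<circ> f))"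
      by (rule uniformly_totally_bounded_on_Cauchy_subseq)
    then have Cauchy: "uniformly_Cauchy_on (lip0_ball zN) (\<lambda>n. free_lift zN f (s (r n)))"
      by (simp add: uniformly_Cauchy_on_def free_lift_apply_ball)
    have image: "free_lift zN f (s (r n)) \<in> free_space zN" for n
      using s by (intro free_lift_in_free_space) simp
    then obtain \<Psi> where \<Psi>: "\<Psi> \<in> lip0_dual zN"
      and lim: "uniform_limit (lip0_ball zN) (\<lambda>n. free_lift zN f (s (r n))) \<Psi> sequentially"
      using lip0_dual_complete[OF free_space_imp_lip0_dual Cauchy] by blast
    have "(\<lambda>n. dual_norm zN (\<lambda>g. free_lift zN f (s (r n)) g - \<Psi> g)) \<longlonglongrightarrow> 0"
      using lim \<Psi> image by (simp add: dual_norm_diff_tendsto_0_iff free_space_imp_lip0_dual)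
    with r free_space_closed[OF image \<Psi> lim]
    show "\<exists>r \<Psi>. strict_mono r \<and> \<Psi> \<in> free_space zN \<and>
        (\<lambda>n. dual_norm zN (\<lambda>g. free_lift zN f (s (r n)) g - \<Psi> g)) \<longlonglongrightarrow> 0"
      by blast
  qed
qed (rule free_lift_compact_imp_precompact_slopes)

end
section \<open>Precompact slopes imply the metric conditions\<close>

definition totally_bounded_on_bounded :: "('a::metric_space \<Rightarrow> 'b::metric_space) \<Rightarrow> bool" where
  "totally_bounded_on_bounded f \<longleftrightarrow> (\<forall>S. bounded S \<longrightarrow> totally_bounded (f ` S))"

definition uniformly_locally_flat :: "('a::metric_space \<Rightarrow> 'b::metric_space) \<Rightarrow> bool" where
  "uniformly_locally_flat f \<longleftrightarrow> (\<forall>\<epsilon>>0. \<exists>\<delta>>0. \<forall>x y.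
    0 < dist x y \<and> dist x y \<le> \<delta> \<longrightarrow> dist (f x) (f y) \<le> \<epsilon> * dist x y)"

definition accumulating_or_flat_at_infinity ::
    "'a::metric_space \<Rightarrow> ('a \<Rightarrow> 'b::metric_space) \<Rightarrow> bool" where
  "accumulating_or_flat_at_infinity z f \<longleftrightarrow> (\<forall>xs ys :: nat \<Rightarrow> 'a.
    (\<forall>n. xs n \<noteq> ys n) \<and>
    filterlim (\<lambda>n. dist (xs n) z) at_top sequentially \<and>
    filterlim (\<lambda>n. dist (ys n) z) at_top sequentially \<longrightarrow>
    (\<exists>p r. strict_mono r \<and> (\<lambda>n. (f (xs (r n)), f (ys (r n)))) \<longlonglongrightarrow> p) \<or>
    liminf (\<lambda>n. ereal (dilation f (xs n) (ys n))) = 0)"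

lemma bump_in_lip0_ball:
  "(\<lambda>w. of_real (max 0 (\<rho> - dist w u) - max 0 (\<rho> - dist z u)) :: 'k::real_normed_field) \<in> lip0_ball z"
proof -
  have "\<bar>max 0 (\<rho> - dist x u) - max 0 (\<rho> - dist y u)\<bar> \<le> dist x y" for x y
    using dist_triangle[of x u y] dist_triangle[of y u x] by (auto simp: max_def dist_commute)
  then show ?thesis
    by (simp add: lip0_ball_iff_lipschitz lipschitz_on_def dist_norm flip: of_real_diff)
qed

text \<open>Test with the bump of radius \<open>\<alpha> * dist u v\<close> around \<open>u\<close>: it vanishes at \<open>v\<close>, so its first
  quotient is large, and the second one must be positive. Constants do not affect the quotients.\<close>

lemma dist_less_if_quotients_close:
  fixes u v u' v' z :: "'b::metric_space"
  assumes close: "\<And>g :: 'b \<Rightarrow> 'k::real_normed_field. g \<in> lip0_ball z \<Longrightarrow>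
      dist ((g u - g v) / of_real d) ((g u' - g v') / of_real d') < \<eta>"
    and "0 < d" "0 \<le> d'" and \<eta>: "\<eta> * d \<le> \<alpha> * dist u v" and "\<alpha> \<le> 1"
  shows "dist u' u < \<alpha> * dist u v"
proof -
  define \<rho> where "\<rho> = \<alpha> * dist u v"
  define b where "b w = max 0 (\<rho> - dist w u)" for w
  define g :: "'b \<Rightarrow> 'k" where "g w = of_real (b w - b z)" for w
  have quotient: "(g x - g y) / of_real t = of_real ((b x - b y) / t)" for x y t
    by (simp add: g_def diff_divide_distrib)
  have "g \<in> lip0_ball z"
    unfolding g_def[abs_def] b_def by (rule bump_in_lip0_ball)
  from close[OF this] have near: "\<bar>(b u - b v) / d - (b u' - b v') / d'\<bar> < \<eta>"
    unfolding quotient dist_of_real dist_real_def .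
  then have "0 < \<eta> * d" using \<open>0 < d\<close> by simp
  then have "b u = \<rho>" using \<eta> by (simp add: b_def \<rho>_def)
  moreover have "\<rho> \<le> dist u v"
    using mult_right_mono[OF \<open>\<alpha> \<le> 1\<close>, of "dist u v"] by (simp add: \<rho>_def)
  then have "b v = 0" by (simp add: b_def dist_commute)
  moreover have "\<eta> \<le> \<rho> / d" using \<eta> \<open>0 < d\<close> by (simp add: \<rho>_def le_divide_eq)
  ultimately have "0 < (b u' - b v') / d'" using near by simp
  then have "b v' < b u'" using \<open>0 \<le> d'\<close> by (auto simp: zero_less_divide_iff)
  moreover have "0 \<le> b v'" by (simp add: b_def)
  ultimately have "0 < b u'" by simp
  then show ?thesis by (simp add: b_def \<rho>_def less_max_iff_disj)
qed

lemma dists_less_if_quotients_close: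
  fixes u v u' v' z :: "'b::metric_space"
  assumes close: "\<And>g :: 'b \<Rightarrow> 'k::real_normed_field. g \<in> lip0_ball z \<Longrightarrow>
      dist ((g u - g v) / of_real d) ((g u' - g v') / of_real d') < \<eta>"
    and d: "0 < d" "0 \<le> d'" and \<eta>: "\<eta> * d \<le> \<alpha> * dist u v" and "\<alpha> \<le> 1"
  shows "dist u' u < \<alpha> * dist u v" "dist v' v < \<alpha> * dist u v"
proof -
  show "dist u' u < \<alpha> * dist u v"
    by (rule dist_less_if_quotients_close[OF close d \<eta> \<open>\<alpha> \<le> 1\<close>])
  have "dist ((g v - g u) / of_real d) ((g v' - g u') / of_real d') < \<eta>"
    if "g \<in> lip0_ball z" for g :: "'b \<Rightarrow> 'k"
    using close[OF that] dist_minus[of "(g u - g v) / of_real d" "(g u' - g v') / of_real d'"]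
    by (simp only: minus_divide_left minus_diff_eq)
  then show "dist v' v < \<alpha> * dist u v"
    using d \<eta> \<open>\<alpha> \<le> 1\<close> unfolding dist_commute[of u v] by (rule dist_less_if_quotients_close)
qed

lemma dist_comparable_if_close:
  assumes "dist u' u < 1/4 * dist u v" "dist v' v < 1/4 * dist u v"
  shows "dist u v / 2 \<le> dist u' v'" "dist u' v' \<le> 2 * dist u v"
proof -
  have "dist u v \<le> dist u' u + dist u' v' + dist v' v" "dist u' v' \<le> dist u' u + dist u v + dist v' v"
    by metric+
  then show "dist u v / 2 \<le> dist u' v'" "dist u' v' \<le> 2 * dist u v"
    using assms by simp_all
qed

lemma convergent_to_distinct_limits:
  fixes u v :: "nat \<Rightarrow> 'b::complete_space"
  assumes close: "\<And>\<alpha>. 0 < \<alpha> \<Longrightarrow> \<alpha> < 1 \<Longrightarrow> \<exists>N. \<forall>m\<ge>N. \<forall>n\<ge>N.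
      dist (u m) (u n) < \<alpha> * dist (u n) (v n) \<and> dist (v m) (v n) < \<alpha> * dist (u n) (v n)"
  obtains l k where "u \<longlonglongrightarrow> l" "v \<longlonglongrightarrow> k" "l \<noteq> k"
proof -
  obtain N where N: "dist (u m) (u n) < 1/4 * dist (u n) (v n)"
    "dist (v m) (v n) < 1/4 * dist (u n) (v n)"
    if "N \<le> m" "N \<le> n" for m n
    using close[of "1/4"] by auto
  define D where "D = dist (u N) (v N)"
  have "0 < D" using N(1)[of N N] by (simp add: D_def)
  have dist_bounds: "D / 2 \<le> dist (u m) (v m)" "dist (u m) (v m) \<le> 2 * D" if "N \<le> m" for m
    using dist_comparable_if_close[OF N[OF that order_refl]] by (simp_all add: D_def)
  have close_D: "\<exists>M. \<forall>m\<ge>M. \<forall>n\<ge>M. dist (u m) (u n) < e \<and> dist (v m) (v n) < e" if "0 < e" for e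
  proof -
    define \<alpha> where "\<alpha> = min (1/2) (e / (2 * D))"
    have "0 < \<alpha>" "\<alpha> < 1" using \<open>0 < e\<close> \<open>0 < D\<close> by (auto simp: \<alpha>_def)
    have "\<alpha> * (2 * D) \<le> e"
      using \<open>0 < D\<close> by (simp add: \<alpha>_def flip: pos_le_divide_eq)
    obtain M where M: "dist (u m) (u n) < \<alpha> * dist (u n) (v n)"
      "dist (v m) (v n) < \<alpha> * dist (u n) (v n)"
      if "M \<le> m" "M \<le> n" for m n
      using close[OF \<open>0 < \<alpha>\<close> \<open>\<alpha> < 1\<close>] by auto
    have "\<alpha> * dist (u n) (v n) \<le> e" if "N \<le> n" for n
      using mult_left_mono[OF dist_bounds(2)[OF that], of \<alpha>] \<open>0 < \<alpha>\<close> \<open>\<alpha> * (2 * D) \<le> e\<close> by linarith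
    then have "dist (u m) (u n) < e \<and> dist (v m) (v n) < e" if "max M N \<le> m" "max M N \<le> n" for m n
      using M[of m n] that by (meson less_le_trans max.boundedE)
    then show ?thesis by blast
  qed
  have "Cauchy u" "Cauchy v"
    using close_D unfolding Cauchy_def by blast+
  then obtain l k where lim: "u \<longlonglongrightarrow> l" "v \<longlonglongrightarrow> k"
    using Cauchy_convergent unfolding convergent_def by blast
  have "D / 2 \<le> dist l k"
    using tendsto_dist[OF lim] dist_bounds(1)
    by (rule tendsto_lowerbound[OF _ eventually_sequentiallyI]) simp_all
  then have "l \<noteq> k" using \<open>0 < D\<close> by auto
  then show thesis by (rule that[OF lim])
qed

lemma precompact_slopes_steep_subseq:
  fixes f :: "'a::metric_space \<Rightarrow> 'b::complete_space" and xs ys :: "nat \<Rightarrow> 'a"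
  assumes slopes: "precompact_slopes TYPE('k::real_normed_field) z f"
    and "0 < c" and steep: "\<And>n. c \<le> dilation f (xs n) (ys n)"
  obtains r u v where "strict_mono r" "(\<lambda>n. f (xs (r n))) \<longlonglongrightarrow> u" "(\<lambda>n. f (ys (r n))) \<longlonglongrightarrow> v" "u \<noteq> v"
proof -
  obtain r :: "nat \<Rightarrow> nat" where r: "strict_mono r" and
    Cauchy: "uniformly_Cauchy_on (lip0_ball z :: ('b \<Rightarrow> 'k) set) (\<lambda>n. slope f (xs (r n)) (ys (r n)))"
    by (rule precompact_slopes_Cauchy_subseq[OF slopes])
  define u v where "u n = f (xs (r n))" and "v n = f (ys (r n))" for n
  define d where "d n = dist (xs (r n)) (ys (r n))" for n
  have d: "0 < d n" "c * d n \<le> dist (u n) (v n)" for n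
    using steep[of "r n"] by (auto simp: le_dilation_iff[OF \<open>0 < c\<close>] u_def v_def d_def)
  have "\<exists>N. \<forall>m\<ge>N. \<forall>n\<ge>N.
      dist (u m) (u n) < \<alpha> * dist (u n) (v n) \<and> dist (v m) (v n) < \<alpha> * dist (u n) (v n)"
    if \<alpha>: "0 < \<alpha>" "\<alpha> < 1" for \<alpha>
  proof -
    obtain N where "\<forall>g :: 'b \<Rightarrow> 'k \<in> lip0_ball z. \<forall>n\<ge>N. \<forall>m\<ge>N.
        dist (slope f (xs (r n)) (ys (r n)) g) (slope f (xs (r m)) (ys (r m)) g) < \<alpha> * c"
      using Cauchy \<open>0 < c\<close> \<open>0 < \<alpha>\<close> unfolding uniformly_Cauchy_on_def by (meson mult_pos_pos)
    then have N: "dist ((g (u n) - g (v n)) / of_real (d n))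
        ((g (u m) - g (v m)) / of_real (d m)) < \<alpha> * c"
      if "g \<in> lip0_ball z" "N \<le> m" "N \<le> n" for g :: "'b \<Rightarrow> 'k" and m n
      using that by (simp add: slope_def u_def v_def d_def)
    have "dist (u m) (u n) < \<alpha> * dist (u n) (v n) \<and> dist (v m) (v n) < \<alpha> * dist (u n) (v n)"
      if mn: "N \<le> m" "N \<le> n" for m n
    proof -
      have "\<alpha> * c * d n \<le> \<alpha> * dist (u n) (v n)"
        using mult_left_mono[OF d(2), of \<alpha> n] \<open>0 < \<alpha>\<close> by (simp add: mult.assoc)
      from dists_less_if_quotients_close[OF N[OF _ mn] d(1) less_imp_le[OF d(1)] this] \<open>\<alpha> < 1\<close>
      show ?thesis by simp
    qed
    then show ?thesis by blast
  qed
  then obtain l k where "u \<longlonglongrightarrow> l" "v \<longlonglongrightarrow> k" "l \<noteq> k"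
    by (rule convergent_to_distinct_limits)
  then show thesis using that[OF r] by (simp add: u_def[abs_def] v_def[abs_def])
qed

lemma precompact_slopes_imp_totally_bounded_on_bounded:
  fixes f :: "'a::metric_space \<Rightarrow> 'b::complete_space"
  assumes slopes: "precompact_slopes TYPE('k::real_normed_field) z f"
  shows "totally_bounded_on_bounded f"
  unfolding totally_bounded_on_bounded_def totally_bounded_metric
proof (intro allI impI)
  fix S :: "'a set" and e :: real assume "bounded S" "0 < e"
  show "\<exists>k. finite k \<and> f ` S \<subseteq> (\<Union>x\<in>k. {y. dist x y < e})"
  proof (cases S "\<lambda>t x. dist (f t) (f x) < e" rule: finite_net_or_separated_sequence)
    case (net T)
    then show ?thesis by (intro exI[of _ "f ` T"]) auto
  next
    case (separated s)
    define B where "B = diameter S + 1"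
    have B: "0 < B" "0 < e / B"
      using diameter_ge_0[OF \<open>bounded S\<close>] \<open>0 < e\<close> by (simp_all add: B_def)
    have steep: "e / B \<le> dilation f (s n) (s (Suc n))" for n
    proof -
      have sep: "e \<le> dist (f (s n)) (f (s (Suc n)))" using separated(2)[of n "Suc n"] by simp
      have "dist (s n) (s (Suc n)) \<le> B"
        using diameter_bounded_bound[OF \<open>bounded S\<close>, of "s n" "s (Suc n)"]
          range_subsetD[OF separated(1)]
        by (simp add: B_def add_increasing2)
      then have "e / B * dist (s n) (s (Suc n)) \<le> e / B * B"
        using B(2) by (intro mult_left_mono) auto
      also have "\<dots> \<le> dist (f (s n)) (f (s (Suc n)))" using sep B(1) by simp
      finally show ?thesis using sep \<open>0 < e\<close> by (auto simp: le_dilation_iff[OF B(2)])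
    qed
    obtain r u where r: "strict_mono r" "(\<lambda>n. f (s (r n))) \<longlonglongrightarrow> u"
      by (rule precompact_slopes_steep_subseq[OF slopes B(2) steep])
    obtain M where "\<forall>m\<ge>M. \<forall>n\<ge>M. dist (f (s (r m))) (f (s (r n))) < e"
      using LIMSEQ_imp_Cauchy[OF r(2)] \<open>0 < e\<close> unfolding Cauchy_def by blast
    then have "dist (f (s (r M))) (f (s (r (Suc M)))) < e" by simp
    then show ?thesis
      using separated(2)[of "r M" "r (Suc M)"] r(1) by (simp add: strict_mono_Suc_iff)
  qed
qed

lemma precompact_slopes_imp_uniformly_locally_flat:
  fixes f :: "'a::metric_space \<Rightarrow> 'b::complete_space"
  assumes slopes: "precompact_slopes TYPE('k::real_normed_field) z f" and lip: "C-lipschitz_on UNIV f"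
  shows "uniformly_locally_flat f"
  unfolding uniformly_locally_flat_def
proof (rule ccontr)
  assume "\<not> (\<forall>\<epsilon>>0. \<exists>\<delta>>0. \<forall>x y. 0 < dist x y \<and> dist x y \<le> \<delta> \<longrightarrow> dist (f x) (f y) \<le> \<epsilon> * dist x y)"
  then obtain \<epsilon> where "0 < \<epsilon>"
    and "\<forall>\<delta>>0. \<exists>x y. 0 < dist x y \<and> dist x y \<le> \<delta> \<and> \<epsilon> * dist x y < dist (f x) (f y)"
    by (auto simp: not_le)
  then have "\<forall>n. \<exists>x y. 0 < dist x y \<and> dist x y \<le> inverse (real (Suc n)) \<and>
      \<epsilon> * dist x y < dist (f x) (f y)"
    by simp
  then obtain xs ys where ne: "\<And>n. 0 < dist (xs n) (ys n)"
    and short: "\<And>n. dist (xs n) (ys n) \<le> inverse (real (Suc n))"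
    and steep: "\<And>n. \<epsilon> * dist (xs n) (ys n) < dist (f (xs n)) (f (ys n))"
    by metis
  have "\<epsilon> \<le> dilation f (xs n) (ys n)" for n
    using ne[of n] steep[of n] by (auto simp: le_dilation_iff[OF \<open>0 < \<epsilon>\<close>])
  then obtain r u v where r: "strict_mono r"
    and lim: "(\<lambda>n. f (xs (r n))) \<longlonglongrightarrow> u" "(\<lambda>n. f (ys (r n))) \<longlonglongrightarrow> v" and "u \<noteq> v"
    by (rule precompact_slopes_steep_subseq[OF slopes \<open>0 < \<epsilon>\<close>])
  have "(\<lambda>n. C * inverse (real (Suc n))) \<longlonglongrightarrow> 0"
    using tendsto_mult_right_zero[OF LIMSEQ_inverse_real_of_nat] .
  then have "(\<lambda>n. C * inverse (real (Suc (r n)))) \<longlonglongrightarrow> 0"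
    by (rule filterlim_compose[OF _ filterlim_subseq[OF r]])
  moreover have "dist (f (xs (r n))) (f (ys (r n))) \<le> C * inverse (real (Suc (r n)))" for n
    using lipschitz_onD[OF lip] mult_left_mono[OF short lipschitz_on_nonneg[OF lip]]
    by (rule order_trans) simp_all
  ultimately have "dist u v \<le> 0"
    by (intro tendsto_le[OF _ _ tendsto_dist[OF lim]]) auto
  with \<open>u \<noteq> v\<close> show False by simp
qed

lemma precompact_slopes_imp_accumulating_or_flat_at_infinity:
  fixes f :: "'a::metric_space \<Rightarrow> 'b::complete_space"
  assumes slopes: "precompact_slopes TYPE('k::real_normed_field) z f"
  shows "accumulating_or_flat_at_infinity w f"
  unfolding accumulating_or_flat_at_infinity_def
proof (intro allI impI disjCI)
  fix xs ys :: "nat \<Rightarrow> 'a"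
  assume "liminf (\<lambda>n. ereal (dilation f (xs n) (ys n))) \<noteq> 0"
  then obtain c N where "0 < c" "\<And>n. N \<le> n \<Longrightarrow> c \<le> dilation f (xs n) (ys n)"
    by (auto simp: liminf_ereal_neq_0_iff dilation_nonneg eventually_sequentially)
  then have "c \<le> dilation f (xs (n + N)) (ys (n + N))" for n by simp
  then obtain r u v where r: "strict_mono r"
    and lim: "(\<lambda>n. f (xs (r n + N))) \<longlonglongrightarrow> u" "(\<lambda>n. f (ys (r n + N))) \<longlonglongrightarrow> v"
    by (rule precompact_slopes_steep_subseq[OF slopes \<open>0 < c\<close>])
  show "\<exists>p r. strict_mono r \<and> (\<lambda>n. (f (xs (r n)), f (ys (r n)))) \<longlonglongrightarrow> p"
    using r tendsto_Pair[OF lim]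
    by (intro exI[of _ "(u, v)"] exI[of _ "\<lambda>n. r n + N"]) (simp add: strict_mono_def)
qed

section \<open>The metric conditions imply precompact slopes\<close>

lemma uniform_limit_quotients:
  assumes a: "(a \<longlongrightarrow> u) F" and b: "(b \<longlongrightarrow> v) F" and d: "(d \<longlongrightarrow> t) F" and "t \<noteq> 0"
  shows "uniform_limit (lip0_ball z :: ('b::metric_space \<Rightarrow> 'k::real_normed_field) set)
    (\<lambda>n g. (g (a n) - g (b n)) / of_real (d n)) (\<lambda>g. (g u - g v) / of_real t) F"
proof -
  have eval: "uniform_limit (lip0_ball z) (\<lambda>n (g :: 'b \<Rightarrow> 'k). g (x n)) (\<lambda>g. g l) F"
    if "(x \<longlongrightarrow> l) F" for x l
  proof (rule uniform_limitI)
    fix e :: real assume "0 < e"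
    with that have "\<forall>\<^sub>F n in F. dist (x n) l < e" by (rule tendstoD)
    then show "\<forall>\<^sub>F n in F. \<forall>g :: 'b \<Rightarrow> 'k \<in> lip0_ball z. dist (g (x n)) (g l) < e"
      by (rule eventually_mono) (blast intro: le_less_trans lip0_ball_dist_le)
  qed
  have "((\<lambda>n. of_real (inverse (d n)) :: 'k) \<longlongrightarrow> of_real (inverse t)) F"
    using \<open>t \<noteq> 0\<close> by (intro tendsto_intros d)
  then have factor: "uniform_limit (lip0_ball z) (\<lambda>n (g :: 'b \<Rightarrow> 'k). of_real (inverse (d n)) :: 'k)
      (\<lambda>g. of_real (inverse t)) F"
    by (auto simp: uniform_limit_iff tendsto_iff elim: eventually_mono)
  have "bounded ((\<lambda>g :: 'b \<Rightarrow> 'k. g u - g v) ` lip0_ball z)"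
    by (rule boundedI[of _ "dist u v"]) (auto simp: lip0_ball_dist_le simp flip: dist_norm)
  then have "uniform_limit (lip0_ball z)
      (\<lambda>n (g :: 'b \<Rightarrow> 'k). (g (a n) - g (b n)) * of_real (inverse (d n)))
      (\<lambda>g. (g u - g v) * of_real (inverse t)) F"
    by (intro uniform_lim_mult uniform_limit_minus eval a b factor) (auto simp: image_constant_conv)
  then show ?thesis by (simp add: divide_inverse)
qed

locale metrically_compact = pointed_lipschitz f zM zN C
  for f :: "'a::metric_space \<Rightarrow> 'b::complete_space" and zM zN C +
  assumes totally_bounded_on_bounded: "totally_bounded_on_bounded f"
    and uniformly_locally_flat: "uniformly_locally_flat f"
    and accumulating_or_flat_at_infinity: "accumulating_or_flat_at_infinity zM f"
begin

lemma dist_image_base_le: "dist (f x) zN \<le> C * dist x zM"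
  using lipschitz_onD[OF lipschitz, of x zM] base by simp

lemma steep_at_infinity_subseq:
  fixes xs ys :: "nat \<Rightarrow> 'a"
  assumes "filterlim (\<lambda>n. dist (xs n) zM) at_top sequentially"
    and "filterlim (\<lambda>n. dist (ys n) zM) at_top sequentially"
    and "0 < c" and steep: "\<And>n. c \<le> dilation f (xs n) (ys n)"
  obtains r p where "strict_mono r" "(\<lambda>n. (f (xs (r n)), f (ys (r n)))) \<longlonglongrightarrow> p"
proof -
  have "liminf (\<lambda>n. ereal (dilation f (xs n) (ys n))) \<noteq> 0"
    using steep \<open>0 < c\<close> by (auto simp: liminf_ereal_neq_0_iff dilation_nonneg)
  moreover have "xs n \<noteq> ys n" for n
    using steep[of n] by (simp add: le_dilation_iff[OF \<open>0 < c\<close>])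
  ultimately show thesis
    using accumulating_or_flat_at_infinity assms(1,2) that
    unfolding accumulating_or_flat_at_infinity_def by blast
qed

lemma quarter_le_dilation_if_farther:
  assumes "0 < c" and growth: "c * dist y zM \<le> dist (f y) zN"
    and farther: "dist x zM < dist y zM" and far: "2 * C / c * dist x zM \<le> dist y zM"
  shows "c / 4 \<le> dilation f x y"
proof -
  have "C * dist x zM \<le> c / 2 * dist y zM"
    using mult_left_mono[OF far, of c] \<open>0 < c\<close> by simp
  moreover have "dist (f y) zN \<le> dist (f x) (f y) + dist (f x) zN" by metric
  ultimately have "c / 2 * dist y zM \<le> dist (f x) (f y)"
    using growth dist_image_base_le[of x] by simp
  moreover have "c / 4 * dist x y \<le> c / 4 * (2 * dist y zM)"
    using \<open>0 < c\<close> farther dist_triangle2[of x y zM] by (intro mult_left_mono) auto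
  ultimately have "c / 4 * dist x y \<le> dist (f x) (f y)" by linarith
  moreover have "x \<noteq> y" using farther by auto
  ultimately show ?thesis using \<open>0 < c\<close> by (intro le_dilation_iff[THEN iffD2] conjI) simp_all
qed

text \<open>Otherwise, pairing points where the growth is linear with much farther ones gives steep pairs
  that escape to infinity at both ends and whose images are unbounded.\<close>

lemma sublinear_growth:
  assumes "0 < c"
  shows "\<exists>R. \<forall>x. R \<le> dist x zM \<longrightarrow> dist (f x) zN < c * dist x zM"
proof (rule ccontr)
  assume "\<not> ?thesis"
  then have "\<forall>R. \<exists>x. R \<le> dist x zM \<and> c * dist x zM \<le> dist (f x) zN" by (simp add: not_less)
  then obtain w where w: "\<And>R. R \<le> dist (w R) zM" "\<And>R. c * dist (w R) zM \<le> dist (f (w R)) zN"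
    by metis
  define xs where "xs n = w (real n)" for n
  define ys where "ys n = w ((1 + 2 * C / c) * dist (xs n) zM + 1)" for n
  have xs_inf: "filterlim (\<lambda>n. dist (xs n) zM) at_top sequentially"
    by (rule filterlim_at_top_mono[OF filterlim_real_sequentially]) (simp add: xs_def w(1))
  have far: "(1 + 2 * C / c) * dist (xs n) zM + 1 \<le> dist (ys n) zM" for n
    unfolding ys_def by (rule w(1))
  have farther: "dist (xs n) zM < dist (ys n) zM" for n
  proof -
    have "1 * dist (xs n) zM \<le> (1 + 2 * C / c) * dist (xs n) zM"
      using C_nonneg \<open>0 < c\<close> by (intro mult_right_mono) auto
    then show ?thesis using far[of n] by simp
  qed
  then have ys_inf: "filterlim (\<lambda>n. dist (ys n) zM) at_top sequentially"
    by (intro filterlim_at_top_mono[OF xs_inf] always_eventually) (simp add: less_imp_le)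
  have steep: "c / 4 \<le> dilation f (xs n) (ys n)" for n
  proof (rule quarter_le_dilation_if_farther[OF \<open>0 < c\<close> _ farther])
    show "c * dist (ys n) zM \<le> dist (f (ys n)) zN"
      unfolding ys_def by (rule w(2))
    show "2 * C / c * dist (xs n) zM \<le> dist (ys n) zM"
      using far[of n] zero_le_dist[of "xs n" zM] unfolding distrib_right by linarith
  qed
  have "0 < c / 4" using \<open>0 < c\<close> by simp
  obtain r p where r: "strict_mono r" and p: "(\<lambda>n. (f (xs (r n)), f (ys (r n)))) \<longlonglongrightarrow> p"
    by (rule steep_at_infinity_subseq[OF xs_inf ys_inf \<open>0 < c / 4\<close> steep])
  have "(\<lambda>n. dist (f (xs (r n))) zN) \<longlonglongrightarrow> dist (fst p) zN"
    using tendsto_dist[OF tendsto_fst[OF p] tendsto_const] by simp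
  moreover have "filterlim (\<lambda>n. c * dist (xs (r n)) zM) at_top sequentially"
    using filterlim_compose[OF xs_inf filterlim_subseq[OF r]] \<open>0 < c\<close>
    by (intro filterlim_tendsto_pos_mult_at_top[OF tendsto_const])
  then have "filterlim (\<lambda>n. dist (f (xs (r n))) zN) at_top sequentially"
    by (rule filterlim_at_top_mono) (simp add: w(2) xs_def)
  ultimately show False
    by (rule not_tendsto_and_filterlim_at_infinity
        [OF sequentially_bot _ filterlim_at_top_imp_at_infinity])
qed

lemma steep_pair_bounded:
  assumes "0 < c"
  shows "\<exists>B'. \<forall>x y. c \<le> dilation f x y \<longrightarrow> dist x zM \<le> B \<longrightarrow> dist y zM \<le> B'"
proof -
  obtain R where R: "\<forall>x. R \<le> dist x zM \<longrightarrow> dist (f x) zN < c / 2 * dist x zM"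
    using sublinear_growth[OF half_gt_zero[OF \<open>0 < c\<close>]] ..
  have "dist y zM \<le> max R (2 * (C + c) * B / c)" if "c \<le> dilation f x y" "dist x zM \<le> B" for x y
  proof (cases "R \<le> dist y zM")
    case True
    have "c * dist y zM \<le> c * (B + dist x y)"
      using dist_triangle3[of y zM x] that(2) \<open>0 < c\<close> by (intro mult_left_mono) auto
    moreover have "c * dist x y \<le> dist (f x) zN + dist (f y) zN"
      using that(1) dist_triangle2[of "f x" "f y" zN] by (simp add: le_dilation_iff[OF \<open>0 < c\<close>])
    moreover have "dist (f x) zN \<le> C * B"
      using dist_image_base_le[of x] mult_left_mono[OF that(2) C_nonneg] by simp
    moreover have "dist (f y) zN \<le> c / 2 * dist y zM"
      using R True by (simp add: less_imp_le)
    ultimately have "c * dist y zM \<le> 2 * (C + c) * B"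
      unfolding distrib_left distrib_right by linarith
    then show ?thesis using \<open>0 < c\<close> by (simp add: le_max_iff_disj le_divide_eq mult.commute)
  qed simp
  then show ?thesis by (intro exI[of _ "max R (2 * (C + c) * B / c)"]) simp
qed

lemma bounded_pairs_images_subseq:
  fixes xs ys :: "nat \<Rightarrow> 'a"
  assumes bdd: "\<And>n. xs n \<in> cball zM B" "\<And>n. ys n \<in> cball zM B"
  obtains r p where "strict_mono r" "(\<lambda>n. (f (xs (r n)), f (ys (r n)))) \<longlonglongrightarrow> p"
proof -
  let ?K = "closure (f ` cball zM B)"
  have "compact ?K"
    using totally_bounded_on_bounded
    by (simp add: totally_bounded_on_bounded_def compact_closure_iff_totally_bounded)
  then have "seq_compact (?K \<times> ?K)" by (intro compact_imp_seq_compact compact_Times)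
  moreover have "\<forall>n. (f (xs n), f (ys n)) \<in> ?K \<times> ?K"
    using bdd by (auto intro!: closure_subset[THEN subsetD])
  ultimately obtain p r where "strict_mono r" "((\<lambda>n. (f (xs n), f (ys n))) \<circ> r) \<longlonglongrightarrow> p"
    by (rule seq_compactE)
  then show thesis using that by (simp add: o_def)
qed

lemma steep_pairs_images_subseq:
  fixes xs ys :: "nat \<Rightarrow> 'a"
  assumes "0 < c" and steep: "\<And>n. c \<le> dilation f (xs n) (ys n)"
  obtains r p where "strict_mono r" "(\<lambda>n. (f (xs (r n)), f (ys (r n)))) \<longlonglongrightarrow> p"
proof (cases "filterlim (\<lambda>n. dist (xs n) zM) at_top sequentially \<and>
    filterlim (\<lambda>n. dist (ys n) zM) at_top sequentially")
  case True
  then show thesis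
    using steep_at_infinity_subseq[OF _ _ \<open>0 < c\<close>, of xs ys thesis] steep that by simp
next
  case False
  then obtain B where "\<exists>\<^sub>F n in sequentially. dist (xs n) zM < B \<or> dist (ys n) zM < B"
    by (auto simp: filterlim_at_top not_eventually not_le frequently_disj_iff)
  from frequently_sequentially_subseq[OF this]
  obtain r :: "nat \<Rightarrow> nat" where r: "strict_mono r"
    "\<And>n. dist (xs (r n)) zM < B \<or> dist (ys (r n)) zM < B" by blast
  obtain B' where B': "\<forall>x y. c \<le> dilation f x y \<longrightarrow> dist x zM \<le> B \<longrightarrow> dist y zM \<le> B'"
    using steep_pair_bounded[OF \<open>0 < c\<close>] by blast
  have "xs (r n) \<in> cball zM (max B B')" "ys (r n) \<in> cball zM (max B B')" for n
    using r(2)[of n] B' steep[of "r n"] steep[of "r n", unfolded dilation_commute[of f "xs _"]]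
    by (auto simp: le_max_iff_disj less_imp_le dist_commute[of zM])
  then obtain r' p where "strict_mono r'" "(\<lambda>n. (f (xs (r (r' n))), f (ys (r (r' n))))) \<longlonglongrightarrow> p"
    by (rule bounded_pairs_images_subseq)
  then show thesis
    using that[of "\<lambda>n. r (r' n)" p] r(1) by (simp add: strict_mono_def)
qed

lemma steep_dist_bounded_below:
  assumes "0 < c"
  shows "\<exists>\<delta>>0. \<forall>x y. c \<le> dilation f x y \<longrightarrow> \<delta> \<le> dist x y"
proof -
  have "0 < c / 2" using \<open>0 < c\<close> by simp
  with uniformly_locally_flat obtain \<delta> where "0 < \<delta>"
    and \<delta>: "\<forall>x y. 0 < dist x y \<and> dist x y \<le> \<delta> \<longrightarrow> dist (f x) (f y) \<le> c / 2 * dist x y"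
    unfolding uniformly_locally_flat_def by blast
  have "\<delta> \<le> dist x y" if "c \<le> dilation f x y" for x y
  proof (rule ccontr)
    have steep: "0 < dist x y" "c * dist x y \<le> dist (f x) (f y)"
      using that by (auto simp: le_dilation_iff[OF \<open>0 < c\<close>])
    assume "\<not> \<delta> \<le> dist x y"
    then have "c * dist x y \<le> c / 2 * dist x y"
      using steep \<delta>[rule_format, of x y] by simp
    then show False using steep(1) \<open>0 < c\<close> by simp
  qed
  with \<open>0 < \<delta>\<close> show ?thesis by blast
qed

lemma steep_slopes_convergent_subseq:
  fixes xs ys :: "nat \<Rightarrow> 'a"
  assumes "0 < c" and steep: "\<And>n. c \<le> dilation f (xs n) (ys n)"
  obtains r l where "strict_mono r" "uniform_limit (lip0_ball z :: ('b \<Rightarrow> 'k::real_normed_field) set)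
      (\<lambda>n. slope f (xs (r n)) (ys (r n))) l sequentially"
proof -
  obtain r p where r: "strict_mono r" and p: "(\<lambda>n. (f (xs (r n)), f (ys (r n)))) \<longlonglongrightarrow> p"
    by (rule steep_pairs_images_subseq[OF assms])
  note lim = tendsto_fst[OF p] tendsto_snd[OF p]
  obtain \<delta> where "0 < \<delta>" and \<delta>: "\<forall>x y. c \<le> dilation f x y \<longrightarrow> \<delta> \<le> dist x y"
    using steep_dist_bounded_below[OF \<open>0 < c\<close>] by blast
  obtain D where "\<And>n. norm (dist (f (xs (r n))) (f (ys (r n)))) \<le> D"
    using BseqE[OF convergent_imp_Bseq[OF convergentI[OF tendsto_dist[OF lim]]]] by auto
  then have D: "dist (f (xs (r n))) (f (ys (r n))) \<le> D" for n by simp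
  have "\<forall>n. dist (xs (r n)) (ys (r n)) \<in> {\<delta>..D / c}"
  proof
    fix n
    have "c * dist (xs (r n)) (ys (r n)) \<le> D"
      using steep[of "r n"] D[of n] unfolding le_dilation_iff[OF \<open>0 < c\<close>] by linarith
    then show "dist (xs (r n)) (ys (r n)) \<in> {\<delta>..D / c}"
      using \<delta> steep \<open>0 < c\<close> by (simp add: le_divide_eq mult.commute)
  qed
  with compact_imp_seq_compact[OF compact_Icc]
  obtain t r' where t: "t \<in> {\<delta>..D / c}" and r': "strict_mono r'"
    and dist_lim: "((\<lambda>n. dist (xs (r n)) (ys (r n))) \<circ> r') \<longlonglongrightarrow> t"
    by (rule seq_compactE)
  have "uniform_limit (lip0_ball z) (\<lambda>n. slope f (xs (r (r' n))) (ys (r (r' n))))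
      (\<lambda>g :: 'b \<Rightarrow> 'k. (g (fst p) - g (snd p)) / of_real t) sequentially"
    unfolding slope_def[abs_def]
  proof (rule uniform_limit_quotients)
    show "(\<lambda>n. f (xs (r (r' n)))) \<longlonglongrightarrow> fst p" "(\<lambda>n. f (ys (r (r' n)))) \<longlonglongrightarrow> snd p"
      using lim[THEN filterlim_compose, OF filterlim_subseq[OF r']] by simp_all
  qed (use dist_lim t \<open>0 < \<delta>\<close> in \<open>auto simp: o_def\<close>)
  moreover have "strict_mono (\<lambda>n. r (r' n))" using r r' by (simp add: strict_mono_def)
  ultimately show thesis using that by blast
qed

theorem precompact_slopes_if_metrically_compact: "precompact_slopes TYPE('k::real_normed_field) zN f"
proof (rule precompact_slopesI)
  fix xs ys :: "nat \<Rightarrow> 'a"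
  obtain r :: "nat \<Rightarrow> nat" and l :: "('b \<Rightarrow> 'k) \<Rightarrow> 'k" where "strict_mono r"
    "uniform_limit (lip0_ball zN) (\<lambda>n. slope f (xs (r n)) (ys (r n))) l sequentially"
  proof (cases "\<exists>c>0. \<exists>\<^sub>F n in sequentially. c \<le> dilation f (xs n) (ys n)")
    case True
    then obtain c where "0 < c" and "\<exists>\<^sub>F n in sequentially. c \<le> dilation f (xs n) (ys n)" by blast
    from frequently_sequentially_subseq[OF this(2)]
    obtain q :: "nat \<Rightarrow> nat" where q: "strict_mono q"
      "\<And>n. c \<le> dilation f (xs (q n)) (ys (q n))" by blast
    obtain r :: "nat \<Rightarrow> nat" and l :: "('b \<Rightarrow> 'k) \<Rightarrow> 'k" where "strict_mono r"
      "uniform_limit (lip0_ball zN) (\<lambda>n. slope f (xs (q (r n))) (ys (q (r n)))) l sequentially"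
      by (rule steep_slopes_convergent_subseq[OF \<open>0 < c\<close> q(2)])
    then show thesis using that[of "\<lambda>n. q (r n)" l] q(1) by (simp add: strict_mono_def)
  next
    case False
    have "uniform_limit (lip0_ball zN) (\<lambda>n. slope f (xs n) (ys n)) (\<lambda>g :: 'b \<Rightarrow> 'k. 0) sequentially"
    proof (rule uniform_limitI)
      fix e :: real assume "0 < e"
      with False have "\<forall>\<^sub>F n in sequentially. dilation f (xs n) (ys n) < e"
        by (auto simp: not_frequently not_le)
      then show "\<forall>\<^sub>F n in sequentially. \<forall>g :: 'b \<Rightarrow> 'k \<in> lip0_ball zN.
          dist (slope f (xs n) (ys n) g) 0 < e"
        by (rule eventually_mono) (auto intro: le_less_trans norm_slope_le_dilation)
    qed
    then show thesis using that[of "\<lambda>n. n"] by (simp add: strict_mono_def)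
  qed
  then show "\<exists>r. strict_mono r \<and>
      uniformly_Cauchy_on (lip0_ball zN :: ('b \<Rightarrow> 'k) set) (\<lambda>n. slope f (xs (r n)) (ys (r n)))"
    by (intro exI conjI uniformly_convergent_Cauchy) (auto simp: uniformly_convergent_on_def)
qed

end

theorem precompact_slopes_iff:
  fixes f :: "'a::metric_space \<Rightarrow> 'b::complete_space"
  assumes "C-lipschitz_on UNIV f" "f zM = zN"
  shows "precompact_slopes TYPE('k::real_normed_field) zN f \<longleftrightarrow>
    totally_bounded_on_bounded f \<and> uniformly_locally_flat f \<and> accumulating_or_flat_at_infinity zM f"
proof
  assume "precompact_slopes TYPE('k) zN f"
  then show "totally_bounded_on_bounded f \<and> uniformly_locally_flat f \<and>
      accumulating_or_flat_at_infinity zM f"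
    using precompact_slopes_imp_totally_bounded_on_bounded
      precompact_slopes_imp_uniformly_locally_flat
      precompact_slopes_imp_accumulating_or_flat_at_infinity assms(1) by blast
next
  assume "totally_bounded_on_bounded f \<and> uniformly_locally_flat f \<and>
      accumulating_or_flat_at_infinity zM f"
  with assms interpret metrically_compact f zM zN C by unfold_locales simp_all
  show "precompact_slopes TYPE('k) zN f" by (rule precompact_slopes_if_metrically_compact)
qed

theorem theoremA:
  fixes f :: "'a::complete_space \<Rightarrow> 'b::complete_space"
    and zM :: 'a and zN :: 'b
  assumes lip: "\<exists>C. C-lipschitz_on UNIV f"
    and base: "f zM = zN"
  defines "P \<equiv>
     (\<forall>S. bounded S \<longrightarrow> totally_bounded (f ` S)) \<and>
     (\<forall>\<epsilon>>0. \<exists>\<delta>>0. \<forall>x y. 0 < dist x y \<and> dist x y \<le> \<delta> \<longrightarrow>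
          dist (f x) (f y) \<le> \<epsilon> * dist x y) \<and>
     (\<forall>xs ys :: nat \<Rightarrow> 'a.
        (\<forall>n. xs n \<noteq> ys n) \<and>
        filterlim (\<lambda>n. dist (xs n) zM) at_top sequentially \<and>
        filterlim (\<lambda>n. dist (ys n) zM) at_top sequentially \<longrightarrow>
        (\<exists>p r. strict_mono r \<and> (\<lambda>n. (f (xs (r n)), f (ys (r n)))) \<longlonglongrightarrow> p) \<or>
        liminf (\<lambda>n. ereal (dist (f (xs n)) (f (ys n)) / dist (xs n) (ys n))) = 0)"
  shows "(free_lift_compact TYPE(real) zM zN f \<longleftrightarrow> P) \<and>
         (free_lift_compact TYPE(complex) zM zN f \<longleftrightarrow> P)"
proof -
  obtain C where C: "C-lipschitz_on UNIV f" using lip by blast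
  interpret pointed_lipschitz f zM zN C using C base by unfold_locales
  have "P \<longleftrightarrow> totally_bounded_on_bounded f \<and> uniformly_locally_flat f \<and>
      accumulating_or_flat_at_infinity zM f"
    unfolding P_def totally_bounded_on_bounded_def uniformly_locally_flat_def
      accumulating_or_flat_at_infinity_def dilation_def ..
  then show ?thesis
    by (simp only: free_lift_compact_iff_precompact_slopes precompact_slopes_iff[OF C base])
qed

end
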